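(* Let $M$ be a Riemannian surface with Levi-Civita connection $\nabla$, let $L>0$, and let $\mathbf{u}:[0,L]\times\mathbb{R}\to M$, $(m,t)\mapsto\mathbf{u}(m,t)$, be a smooth map, where for each fixed $t\in\mathbb{R}$ the curve $\mathbf{u}([0,L]\times\{t\})$ represents the position at time $t$ of a string vibrating in $M$. Suppose that the string is parametrized by constant density (with density constant $\rho>0$), that it is perfectly elastic (with constant $T_0>0$), and that its motion is governed by Newton's Law. Then, with $c^2=T_0/\rho$, the map $\mathbf{u}(m,t)$ satisfies the wave map equation $$\nabla_{\mathbf{u}_t}\mathbf{u}_t=c^2\,\nabla_{\mathbf{u}_m}\mathbf{u}_m$$ on $[0,L]\times\mathbb{R}$.
   Context: Notation. $\mathbf{u}_m$ and $\mathbf{u}_t$ are the partial derivatives of $\mathbf{u}$, regarded as vector fields along the map $\mathbf{u}$; $\nabla_{\mathbf{u}_m}$ and $\nabla_{\mathbf{u}_t}$ denote covariant differentiation of vector fields along $\mathbf{u}$ in the $m$- and $t$-directions (i.e. with respect to the pulled-back Levi-Civita connection). Constant density. The density of the string is a 1-form $d\mu$ on $[0,L]$ such that the segment of string corresponding to $[a,b]\subset[0,L]$ has mass $\int_a^b d\mu$ at all times. The string is parametrized by constant density if $d\mu=\rho\,dm$ for a constant $\rho>0$; thus the segment corresponding to $[m,m+\Delta m]$ has mass $\rho\,\Delta m$. Perfect elasticity. Let $\sigma(m,t)=\frac{\partial s}{\partial m}(m,t)=|\mathbf{u}_m(m,t)|$ be the stretching factor of the string, where $s$ is arc length along the curve $\mathbf{u}(\cdot,t)$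 and $|\cdot|$ is the Riemannian norm. The string, in its constant density parametrization, is perfectly elastic if there is a constant $T_0>0$ such that the magnitude $T(m,t)$ of the tension in the string at the point $\mathbf{u}(m,t)$ equals $T_0\,\sigma(m,t)$ for all values of $\sigma$ occurring. Tension forces. The tension is directed along the tangent line of the string. On the segment corresponding to $[m,m+\Delta m]$ (with $\Delta m>0$), the tension force at the right-hand end is the vector $\mathbf{T}(m+\Delta m,t)=T(m+\Delta m,t)\,\mathbf{t}(m+\Delta m,t)$ at $\mathbf{u}(m+\Delta m,t)$, and the tension force at the left-hand end is the vector $-T(m,t)\,\mathbf{t}(m,t)$ at $\mathbf{u}(m,t)$, where $\mathbf{t}=\mathbf{u}_m/|\mathbf{u}_m|$ is the unit tangent vector (a force of magnitude $0$ being the zero vector). These are the only forces acting. Newton's Law. The acceleration of the string is $\nabla_{\mathbf{u}_t}\mathbf{u}_t$, and Newton's Law (force $=$ mass $\times$ acceleration) is applied to infinitesimal segments, with forces at different points compared by parallel transport along the curve $\mathbf{u}(\cdot,t)$. That is, for all $m\in(0,L)$ and $t\in\mathbb{R}$, $$\rho\,\nabla_{\mathbf{u}_t}\mathbf{u}_t(m,t)=\lim_{\Delta m\to0^+}\frac{1}{\Delta m}\Big[P_{\Delta m}\big(T(m+\Delta m,t)\,\mathbf{t}(m+\Delta m,t)\big)-T(m,t)\,\mathbf{t}(m,t)\Big],$$ where $P_{\Delta m}:T_{\mathbf{u}(m+\Delta m,t)}M\to T_{\mathbf{u}(m,t)}M$ is parallel transport along $\mathbf{u}(\cdot,t)$ from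 $\mathbf{u}(m+\Delta m,t)$ back to $\mathbf{u}(m,t)$. *)

theory Defs
  imports "HOL-Analysis.Analysis" "HOL-Library.Function_Algebras"
begin

section \<open>Smooth maps between Euclidean spaces\<close>

text \<open>Intended for open \<open>S\<close>: all iterated directional derivatives up to order \<open>k\<close> exist
  (as Frechet derivatives of the preceding one) and are continuous on \<open>S\<close>.\<close>

fun Ck_on :: "nat \<Rightarrow> 'a::real_normed_vector set \<Rightarrow> ('a \<Rightarrow> 'b::real_normed_vector) \<Rightarrow> bool" where
  "Ck_on 0 S f = continuous_on S f"
| "Ck_on (Suc k) S f =
     ((\<forall>x\<in>S. f differentiable (at x)) \<and> (\<forall>v. Ck_on k S (\<lambda>x. frechet_derivative f (at x) v)))"

definition smooth_on :: "'a::real_normed_vector set \<Rightarrow> ('a \<Rightarrow> 'b::real_normed_vector) \<Rightarrow> bool" where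
  "smooth_on S f \<longleftrightarrow> (\<forall>k. Ck_on k S f)"


section \<open>Smooth surfaces\<close>

text \<open>A chart is a pair of a domain and a coordinate map; the values of the map outside the domain
  are irrelevant. A surface is a Hausdorff second countable space \<open>X\<close> with a smooth
  (not necessarily maximal) atlas \<open>A\<close>.\<close>

type_synonym 'p chart = "'p set \<times> ('p \<Rightarrow> real ^ 2)"

abbreviation cdom :: "'p chart \<Rightarrow> 'p set" where "cdom c \<equiv> fst c"
abbreviation cmap :: "'p chart \<Rightarrow> 'p \<Rightarrow> real ^ 2" where "cmap c \<equiv> snd c"
abbreviation cinv :: "'p chart \<Rightarrow> real ^ 2 \<Rightarrow> 'p" where "cinv c \<equiv> inv_into (cdom c) (cmap c)"

definition smooth_surface :: "'p topology \<Rightarrow> 'p chart set \<Rightarrow> bool" where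
  "smooth_surface X A \<longleftrightarrow>
     Hausdorff_space X \<and> second_countable X \<and>
     (\<Union>c\<in>A. cdom c) = topspace X \<and>
     (\<forall>c\<in>A. openin X (cdom c) \<and> open (cmap c ` cdom c) \<and>
        homeomorphic_map (subtopology X (cdom c)) (top_of_set (cmap c ` cdom c)) (cmap c)) \<and>
     (\<forall>c\<in>A. \<forall>d\<in>A. smooth_on (cmap c ` (cdom c \<inter> cdom d)) (cmap d \<circ> cinv c))"

definition charts_at :: "'p chart set \<Rightarrow> 'p \<Rightarrow> 'p chart set" where
  "charts_at A p = {c \<in> A. p \<in> cdom c}"

definition smooth_function ::
    "'p chart set \<Rightarrow> 'p set \<Rightarrow> ('p \<Rightarrow> 'b::real_normed_vector) \<Rightarrow> bool" where
  "smooth_function A U f \<longleftrightarrow> (\<forall>c\<in>A. smooth_on (cmap c ` (U \<inter> cdom c)) (f \<circ> cinv c))"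

text \<open>On an arbitrary (in particular not open) set \<open>S\<close>, as for manifolds with boundary, smoothness
  means that the coordinate expressions extend locally to smooth maps on open sets.\<close>

definition smooth_map_on ::
    "'p topology \<Rightarrow> 'p chart set \<Rightarrow> 'e::real_normed_vector set \<Rightarrow> ('e \<Rightarrow> 'p) \<Rightarrow> bool" where
  "smooth_map_on X A S u \<longleftrightarrow>
     continuous_map (top_of_set S) X u \<and>
     (\<forall>c\<in>A. \<forall>z\<in>S. u z \<in> cdom c \<longrightarrow>
        (\<exists>N F. open N \<and> z \<in> N \<and> smooth_on N F \<and>
           (\<forall>w\<in>N \<inter> S. u w \<in> cdom c \<longrightarrow> F w = cmap c (u w))))"


section \<open>Tangent vectors\<close>

text \<open>Functions form a real vector space pointwise; their topology is the product topology of the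
  library.\<close>

instantiation "fun" :: (type, real_vector) real_vector
begin

definition scaleR_fun :: "real \<Rightarrow> ('a \<Rightarrow> 'b) \<Rightarrow> 'a \<Rightarrow> 'b" where
  "scaleR_fun r f = (\<lambda>x. r *\<^sub>R f x)"

instance
  by standard (simp_all add: scaleR_fun_def fun_eq_iff scaleR_add_right scaleR_add_left)

end

text \<open>A tangent vector at \<open>p\<close> is represented by the family of its component vectors in all charts
  around \<open>p\<close>, which are related by the Jacobians of the coordinate changes. So that equality of
  tangent vectors is equality of functions, the component at any other index is \<open>0\<close>. The topology
  which \<open>tangent_space A p\<close> inherits from the product topology is its usual one, because every
  component is a linear isomorphic image of any other component.\<close>

type_synonym 'p tangent = "'p chart \<Rightarrow> real ^ 2"

definition tangent_space :: "'p chart set \<Rightarrow> 'p \<Rightarrow> 'p tangent set" where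
  "tangent_space A p =
     {v. (\<forall>c. c \<notin> charts_at A p \<longrightarrow> v c = 0) \<and>
         (\<forall>c\<in>charts_at A p. \<forall>d\<in>charts_at A p.
            v d = frechet_derivative (cmap d \<circ> cinv c) (at (cmap c p)) (v c))}"

definition smooth_vector_field ::
    "'p topology \<Rightarrow> 'p chart set \<Rightarrow> 'p set \<Rightarrow> ('p \<Rightarrow> 'p tangent) \<Rightarrow> bool" where
  "smooth_vector_field X A U Y \<longleftrightarrow>
     openin X U \<and> (\<forall>p\<in>U. Y p \<in> tangent_space A p) \<and>
     (\<forall>c\<in>A. smooth_on (cmap c ` (U \<inter> cdom c)) (\<lambda>x. Y (cinv c x) c))"

text \<open>The \<open>j\<close>-th coordinate vector field of the chart \<open>c\<close>, which is a vector field on \<open>cdom c\<close>.\<close>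

definition coord_field :: "'p chart set \<Rightarrow> 'p chart \<Rightarrow> 2 \<Rightarrow> 'p \<Rightarrow> 'p tangent" where
  "coord_field A c j p = (\<lambda>d. if d \<in> charts_at A p
     then frechet_derivative (cmap d \<circ> cinv c) (at (cmap c p)) (axis j 1) else 0)"

text \<open>The derivative \<open>v f\<close> of a function \<open>f\<close> in the direction of \<open>v\<close> in the tangent space at \<open>p\<close>.
  By the chain rule it does not depend on the chart.\<close>

definition dir_deriv :: "'p chart set \<Rightarrow> 'p \<Rightarrow> 'p tangent \<Rightarrow> ('p \<Rightarrow> real) \<Rightarrow> real" where
  "dir_deriv A p v f =
     (let c = SOME c. c \<in> charts_at A p
      in frechet_derivative (f \<circ> cinv c) (at (cmap c p)) (v c))"

definition lie_bracket ::
    "'p chart set \<Rightarrow> ('p \<Rightarrow> 'p tangent) \<Rightarrow> ('p \<Rightarrow> 'p tangent) \<Rightarrow> 'p \<Rightarrow> 'p tangent" where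
  "lie_bracket A Y Z p = (\<lambda>c. if c \<in> charts_at A p
     then frechet_derivative (\<lambda>x. Z (cinv c x) c) (at (cmap c p)) (Y p c)
        - frechet_derivative (\<lambda>x. Y (cinv c x) c) (at (cmap c p)) (Z p c)
     else 0)"


section \<open>Riemannian metrics and the Levi-Civita connection\<close>

definition riemannian_metric ::
    "'p topology \<Rightarrow> 'p chart set \<Rightarrow> ('p \<Rightarrow> 'p tangent \<Rightarrow> 'p tangent \<Rightarrow> real) \<Rightarrow> bool" where
  "riemannian_metric X A g \<longleftrightarrow>
     (\<forall>p\<in>topspace X. \<forall>v\<in>tangent_space A p. \<forall>w\<in>tangent_space A p.
        g p v w = g p w v \<and>
        (v \<noteq> 0 \<longrightarrow> g p v v > 0) \<and>
        (\<forall>v'\<in>tangent_space A p. \<forall>a b. g p (a *\<^sub>R v + b *\<^sub>R v') w = a * g p v w + b * g p v' w)) \<and>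
     (\<forall>U Y Z. smooth_vector_field X A U Y \<longrightarrow> smooth_vector_field X A U Z \<longrightarrow>
        smooth_function A U (\<lambda>p. g p (Y p) (Z p)))"

definition riemannian_surface ::
    "'p topology \<Rightarrow> 'p chart set \<Rightarrow> ('p \<Rightarrow> 'p tangent \<Rightarrow> 'p tangent \<Rightarrow> real) \<Rightarrow> bool" where
  "riemannian_surface X A g \<longleftrightarrow> smooth_surface X A \<and> riemannian_metric X A g"

definition tnorm :: "('p \<Rightarrow> 'p tangent \<Rightarrow> 'p tangent \<Rightarrow> real) \<Rightarrow> 'p \<Rightarrow> 'p tangent \<Rightarrow> real" where
  "tnorm g p v = sqrt (g p v v)"

text \<open>\<open>nabla p v Y\<close> is the covariant derivative at \<open>p\<close>, in the direction of the tangent vector \<open>v\<close> at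
  \<open>p\<close>, of the vector field \<open>Y\<close>, which only needs to be defined and smooth on a neighbourhood of \<open>p\<close>.
  (A connection on global vector fields is a local operator and thus has a unique such extension;
  the point has to be given since the representation of \<open>v\<close> does not determine it.)\<close>

type_synonym 'p connection = "'p \<Rightarrow> 'p tangent \<Rightarrow> ('p \<Rightarrow> 'p tangent) \<Rightarrow> 'p tangent"

definition affine_connection :: "'p topology \<Rightarrow> 'p chart set \<Rightarrow> 'p connection \<Rightarrow> bool" where
  "affine_connection X A nabla \<longleftrightarrow>
     (\<forall>U Y Z. smooth_vector_field X A U Y \<longrightarrow> smooth_vector_field X A U Z \<longrightarrow>
        smooth_vector_field X A U (\<lambda>p. nabla p (Y p) Z)) \<and>
     (\<forall>U Y. smooth_vector_field X A U Y \<longrightarrow>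
        (\<forall>p\<in>U. \<forall>v\<in>tangent_space A p.
           nabla p v Y \<in> tangent_space A p \<and>
           (\<forall>w\<in>tangent_space A p. \<forall>a b.
              nabla p (a *\<^sub>R v + b *\<^sub>R w) Y = a *\<^sub>R nabla p v Y + b *\<^sub>R nabla p w Y) \<and>
           (\<forall>Z. smooth_vector_field X A U Z \<longrightarrow>
              nabla p v (\<lambda>q. Y q + Z q) = nabla p v Y + nabla p v Z) \<and>
           (\<forall>f. smooth_function A U f \<longrightarrow>
              nabla p v (\<lambda>q. f q *\<^sub>R Y q) = dir_deriv A p v f *\<^sub>R Y p + f p *\<^sub>R nabla p v Y) \<and>
           (\<forall>Z. (\<forall>q\<in>U. Z q = Y q) \<longrightarrow> nabla p v Z = nabla p v Y)))"

definition torsion_free :: "'p topology \<Rightarrow> 'p chart set \<Rightarrow> 'p connection \<Rightarrow> bool" where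
  "torsion_free X A nabla \<longleftrightarrow>
     (\<forall>U Y Z. smooth_vector_field X A U Y \<longrightarrow> smooth_vector_field X A U Z \<longrightarrow>
        (\<forall>p\<in>U. nabla p (Y p) Z - nabla p (Z p) Y = lie_bracket A Y Z p))"

definition metric_compatible ::
    "'p topology \<Rightarrow> 'p chart set \<Rightarrow> ('p \<Rightarrow> 'p tangent \<Rightarrow> 'p tangent \<Rightarrow> real) \<Rightarrow> 'p connection \<Rightarrow> bool"
  where
  "metric_compatible X A g nabla \<longleftrightarrow>
     (\<forall>U Y Z. smooth_vector_field X A U Y \<longrightarrow> smooth_vector_field X A U Z \<longrightarrow>
        (\<forall>p\<in>U. \<forall>v\<in>tangent_space A p.
           dir_deriv A p v (\<lambda>q. g q (Y q) (Z q)) = g p (nabla p v Y) (Z p) + g p (Y p) (nabla p v Z)))"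

definition levi_civita_connection ::
    "'p topology \<Rightarrow> 'p chart set \<Rightarrow> ('p \<Rightarrow> 'p tangent \<Rightarrow> 'p tangent \<Rightarrow> real) \<Rightarrow> 'p connection \<Rightarrow> bool"
  where
  "levi_civita_connection X A g nabla \<longleftrightarrow>
     affine_connection X A nabla \<and> torsion_free X A nabla \<and> metric_compatible X A g nabla"


section \<open>Vector fields along curves\<close>

text \<open>Curves and vector fields along them live on an interval \<open>I\<close> of positive length; derivatives at
  an endpoint of \<open>I\<close> are one-sided.\<close>

definition velocity :: "'p chart set \<Rightarrow> real set \<Rightarrow> (real \<Rightarrow> 'p) \<Rightarrow> real \<Rightarrow> 'p tangent" where
  "velocity A I \<gamma> s = (\<lambda>c. if c \<in> charts_at A (\<gamma> s)
     then vector_derivative (\<lambda>r. cmap c (\<gamma> r)) (at s within I) else 0)"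

text \<open>The covariant derivative given by the pulled-back connection. Near \<open>s\<close> a field along \<open>\<gamma>\<close> is
  \<open>V = (\<Sum>j. V\<^sup>j (E\<^sub>j \<circ> \<gamma>))\<close> with the coordinate fields \<open>E\<^sub>j\<close> of a chart \<open>c\<close>, and its derivative is
  \<open>(\<Sum>j. (V\<^sup>j)' (E\<^sub>j \<circ> \<gamma>) + V\<^sup>j \<nabla>\<^bsub>\<gamma>'\<^esub> E\<^sub>j)\<close>; below is the component of this vector in the chart \<open>c\<close>.\<close>

definition cov_deriv_along ::
    "'p chart set \<Rightarrow> 'p connection \<Rightarrow> real set \<Rightarrow> (real \<Rightarrow> 'p) \<Rightarrow> (real \<Rightarrow> 'p tangent) \<Rightarrow> real \<Rightarrow> 'p tangent"
  where
  "cov_deriv_along A nabla I \<gamma> V s = (\<lambda>c. if c \<in> charts_at A (\<gamma> s)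
     then vector_derivative (\<lambda>r. V r c) (at s within I)
        + (\<Sum>j\<in>UNIV. (V s c $ j) *\<^sub>R nabla (\<gamma> s) (velocity A I \<gamma> s) (coord_field A c j) c)
     else 0)"

definition parallel_along ::
    "'p chart set \<Rightarrow> 'p connection \<Rightarrow> real set \<Rightarrow> (real \<Rightarrow> 'p) \<Rightarrow> (real \<Rightarrow> 'p tangent) \<Rightarrow> bool" where
  "parallel_along A nabla I \<gamma> W \<longleftrightarrow>
     (\<forall>s\<in>I. W s \<in> tangent_space A (\<gamma> s) \<and>
        (\<forall>c\<in>charts_at A (\<gamma> s). (\<lambda>r. W r c) differentiable (at s within I)) \<and>
        cov_deriv_along A nabla I \<gamma> W s = 0)"

text \<open>Parallel transport along \<open>\<gamma>\<close> from \<open>\<gamma> b\<close> back to \<open>\<gamma> a\<close>, for \<open>a < b\<close>.\<close>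

definition parallel_transport_back ::
    "'p chart set \<Rightarrow> 'p connection \<Rightarrow> (real \<Rightarrow> 'p) \<Rightarrow> real \<Rightarrow> real \<Rightarrow> 'p tangent \<Rightarrow> 'p tangent" where
  "parallel_transport_back A nabla \<gamma> a b w =
     (THE v. \<exists>W. parallel_along A nabla {a..b} \<gamma> W \<and> W b = w \<and> W a = v)"


section \<open>The vibrating string\<close>

text \<open>The motion is \<open>u m t\<close> with \<open>m\<close> in \<open>{0..L}\<close> and \<open>t\<close> any real number. For fields along \<open>u\<close>, the
  pulled-back connection in the directions of \<open>m\<close> and \<open>t\<close> is covariant differentiation along the
  curves in which the other parameter is fixed.\<close>

definition u_m :: "'p chart set \<Rightarrow> real \<Rightarrow> (real \<Rightarrow> real \<Rightarrow> 'p) \<Rightarrow> real \<Rightarrow> real \<Rightarrow> 'p tangent" where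
  "u_m A L u m t = velocity A {0..L} (\<lambda>r. u r t) m"

definition u_t :: "'p chart set \<Rightarrow> (real \<Rightarrow> real \<Rightarrow> 'p) \<Rightarrow> real \<Rightarrow> real \<Rightarrow> 'p tangent" where
  "u_t A u m t = velocity A UNIV (\<lambda>r. u m r) t"

definition nabla_m ::
    "'p chart set \<Rightarrow> 'p connection \<Rightarrow> real \<Rightarrow> (real \<Rightarrow> real \<Rightarrow> 'p) \<Rightarrow> (real \<Rightarrow> real \<Rightarrow> 'p tangent)
     \<Rightarrow> real \<Rightarrow> real \<Rightarrow> 'p tangent" where
  "nabla_m A nabla L u V m t = cov_deriv_along A nabla {0..L} (\<lambda>r. u r t) (\<lambda>r. V r t) m"

definition nabla_t ::
    "'p chart set \<Rightarrow> 'p connection \<Rightarrow> (real \<Rightarrow> real \<Rightarrow> 'p) \<Rightarrow> (real \<Rightarrow> real \<Rightarrow> 'p tangent)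
     \<Rightarrow> real \<Rightarrow> real \<Rightarrow> 'p tangent" where
  "nabla_t A nabla u V m t = cov_deriv_along A nabla UNIV (\<lambda>r. u m r) (\<lambda>r. V m r) t"

text \<open>The density is the 1-form \<open>mu m dm\<close> on \<open>{0..L}\<close>; being time-independent it expresses that the
  mass of each segment is the same at all times.\<close>

definition constant_density :: "real \<Rightarrow> (real \<Rightarrow> real) \<Rightarrow> real \<Rightarrow> bool" where
  "constant_density L mu rho \<longleftrightarrow> rho > 0 \<and> (\<forall>m\<in>{0..L}. mu m = rho)"

definition stretching ::
    "'p chart set \<Rightarrow> ('p \<Rightarrow> 'p tangent \<Rightarrow> 'p tangent \<Rightarrow> real) \<Rightarrow> real \<Rightarrow> (real \<Rightarrow> real \<Rightarrow> 'p)
     \<Rightarrow> real \<Rightarrow> real \<Rightarrow> real" where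
  "stretching A g L u m t = tnorm g (u m t) (u_m A L u m t)"

text \<open>\<open>T m t\<close> is the magnitude of the tension in the string at \<open>u m t\<close>.\<close>

definition perfectly_elastic ::
    "'p chart set \<Rightarrow> ('p \<Rightarrow> 'p tangent \<Rightarrow> 'p tangent \<Rightarrow> real) \<Rightarrow> real \<Rightarrow> (real \<Rightarrow> real \<Rightarrow> 'p)
     \<Rightarrow> (real \<Rightarrow> real \<Rightarrow> real) \<Rightarrow> real \<Rightarrow> bool" where
  "perfectly_elastic A g L u T T0 \<longleftrightarrow>
     T0 > 0 \<and> (\<forall>m\<in>{0..L}. \<forall>t. T m t = T0 * stretching A g L u m t)"

text \<open>Where \<open>u_m = 0\<close> this is the zero vector, by the convention \<open>inverse 0 = 0\<close>. Under perfect
  elasticity the tension has magnitude \<open>0\<close> exactly at such points.\<close>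

definition unit_tangent ::
    "'p chart set \<Rightarrow> ('p \<Rightarrow> 'p tangent \<Rightarrow> 'p tangent \<Rightarrow> real) \<Rightarrow> real \<Rightarrow> (real \<Rightarrow> real \<Rightarrow> 'p)
     \<Rightarrow> real \<Rightarrow> real \<Rightarrow> 'p tangent" where
  "unit_tangent A g L u m t = inverse (tnorm g (u m t) (u_m A L u m t)) *\<^sub>R u_m A L u m t"

definition tension ::
    "'p chart set \<Rightarrow> ('p \<Rightarrow> 'p tangent \<Rightarrow> 'p tangent \<Rightarrow> real) \<Rightarrow> real \<Rightarrow> (real \<Rightarrow> real \<Rightarrow> 'p)
     \<Rightarrow> (real \<Rightarrow> real \<Rightarrow> real) \<Rightarrow> real \<Rightarrow> real \<Rightarrow> 'p tangent" where
  "tension A g L u T m t = T m t *\<^sub>R unit_tangent A g L u m t"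

text \<open>Force equals mass times acceleration for the segments \<open>{m..m + h}\<close>, divided by \<open>h\<close>, in the
  limit \<open>h \<rightarrow> 0\<close> from the right; the limit is taken in the tangent space at \<open>u m t\<close>.\<close>

definition newtons_law ::
    "'p chart set \<Rightarrow> ('p \<Rightarrow> 'p tangent \<Rightarrow> 'p tangent \<Rightarrow> real) \<Rightarrow> 'p connection \<Rightarrow> real
     \<Rightarrow> (real \<Rightarrow> real \<Rightarrow> 'p) \<Rightarrow> (real \<Rightarrow> real) \<Rightarrow> (real \<Rightarrow> real \<Rightarrow> real) \<Rightarrow> bool" where
  "newtons_law A g nabla L u mu T \<longleftrightarrow>
     (\<forall>m\<in>{0<..<L}. \<forall>t.
        ((\<lambda>h. (1 / h) *\<^sub>R
            (parallel_transport_back A nabla (\<lambda>r. u r t) m (m + h) (tension A g L u T (m + h) t)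
             - tension A g L u T m t))
          \<longlongrightarrow> mu m *\<^sub>R nabla_t A nabla u (u_t A u) m t) (at_right 0))"

end

theory Submission
  imports Defs
begin

text \<open>
  Perfect elasticity cancels the normalisation of the unit tangent: the tension vector is
  \<open>T\<^sub>0 \<sigma> (u_m / \<sigma>) = T\<^sub>0 u_m\<close> where \<open>\<sigma> \<noteq> 0\<close>, and both sides vanish where \<open>\<sigma> = 0\<close>
  (\<open>tension_eq_scaled_u_m\<close>). So the right-hand side of Newton's Law is \<open>T\<^sub>0\<close> times the limit of the
  difference quotients of \<open>u_m\<close> formed with parallel transport. Such a limit is the covariant
  derivative along the curve (\<open>covariant_derivative_by_transport\<close>), here \<open>\<nabla>\<close> of \<open>u_m\<close> in the
  direction of \<open>u_m\<close>. Since Newton's Law exhibits \<open>\<rho>\<close> times the acceleration as the same limit, the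
  wave map equation holds for \<open>0 < m < L\<close>. In a chart both of its sides are continuous
  in \<open>m\<close> up to the ends of the string, so it also holds at \<open>m = 0\<close> and \<open>m = L\<close>.

  The work is in the statement about difference quotients. Parallel transport is given by a
  definite description, hence existence and uniqueness of parallel fields are needed, but only for
  transport over arbitrarily short distances. A short piece of the curve lies in one chart, where a
  field with component \<open>w\<close> is parallel iff \<open>w' = - \<Gamma>(\<gamma>', w)\<close> with the Christoffel symbols \<open>\<Gamma>\<close>.
  This is a differential equation whose right-hand side is Lipschitz in \<open>w\<close>, and on an interval that
  is short compared to the Lipschitz constant it is solved by the contraction principle
  (\<open>short_ode_exists\<close>, \<open>short_ode_unique\<close>). If \<open>W\<close> is the solution that agrees with \<open>V\<close> at \<open>a + h\<close>,
  the mean value inequality for \<open>W - V\<close> gives \<open>W(a) - V(a) = h (V'(a) + \<Gamma>(\<gamma>'(a), V(a))) + o(h)\<close>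
  (\<open>transport_difference_quotient\<close>).

  A solution in one chart is a parallel field only if its covariant derivative vanishes in all the
  other charts as well. This is the tensor character of the covariant derivative
  (\<open>cov_deriv_along_chart_change\<close>): the second derivatives of the coordinate change that come from
  differentiating the components cancel those in the transformation law of the Christoffel symbols
  (\<open>nabla_coord_field_change\<close>).
\<close>

section \<open>Smooth maps between Euclidean spaces\<close>

lemma Ck_on_subset: "Ck_on k T f \<Longrightarrow> S \<subseteq> T \<Longrightarrow> Ck_on k S f"
  by (induction k arbitrary: f) (auto intro: continuous_on_subset)

lemma Ck_on_continuous_on: "Ck_on k S f \<Longrightarrow> continuous_on S f"
  by (cases k) (auto intro!: continuous_at_imp_continuous_on differentiable_imp_continuous_within)

lemma Ck_on_SucD: "Ck_on (Suc k) S f \<Longrightarrow> Ck_on k S f"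
proof (induction k arbitrary: f)
  case 0
  then show ?case using Ck_on_continuous_on[of "Suc 0" S f] by simp
next
  case (Suc k)
  have "Ck_on k S (\<lambda>x. frechet_derivative f (at x) v)" for v
    using Suc.prems by (intro Suc.IH) simp
  then show ?case using Suc.prems by simp
qed

lemma frechet_derivative_cong_open:
  assumes "open S" "x \<in> S" "\<And>y. y \<in> S \<Longrightarrow> f y = g y"
  shows "frechet_derivative f (at x) = frechet_derivative g (at x)"
proof -
  have "(f has_derivative D) (at x) \<longleftrightarrow> (g has_derivative D) (at x)" for D
    using has_derivative_transform_within_open[of f D x UNIV S g, OF _ assms]
      has_derivative_transform_within_open[of g D x UNIV S f, OF _ assms(1,2) assms(3)[symmetric]] by blast
  then show ?thesis by (simp add: frechet_derivative_def)
qed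

lemma differentiable_cong_open:
  assumes "open S" "x \<in> S" "\<And>y. y \<in> S \<Longrightarrow> f y = g y" "f differentiable (at x)"
  shows "g differentiable (at x)"
  using has_derivative_transform_within_open[of f _ x UNIV S g, OF _ assms(1-3)] assms(4)
  unfolding differentiable_def by blast

lemma Ck_on_cong:
  assumes "open S" "\<And>x. x \<in> S \<Longrightarrow> f x = g x" "Ck_on k S f"
  shows "Ck_on k S g"
  using assms(2,3)
proof (induction k arbitrary: f g)
  case 0
  then show ?case by (metis Ck_on.simps(1) continuous_on_cong)
next
  case (Suc k)
  have "Ck_on k S (\<lambda>x. frechet_derivative g (at x) v)" for v
  proof (rule Suc.IH)
    show "Ck_on k S (\<lambda>x. frechet_derivative f (at x) v)" using Suc.prems by simp
    show "frechet_derivative f (at x) v = frechet_derivative g (at x) v" if "x \<in> S" for x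
      using frechet_derivative_cong_open[OF assms(1) that, of f g] Suc.prems(1) by simp
  qed
  moreover have "g differentiable (at x)" if "x \<in> S" for x
    using differentiable_cong_open[OF assms(1) that, of f g] Suc.prems that by simp
  ultimately show ?case by simp
qed

lemma Ck_on_const: "Ck_on k S (\<lambda>x. c)"
proof (induction k arbitrary: c)
  case (Suc k)
  have "frechet_derivative (\<lambda>x. c) (at x) = (\<lambda>v. 0)" for x :: 'a
    by (rule frechet_derivative_at[symmetric]) simp
  then show ?case using Suc by simp
qed simp

lemma Ck_on_bounded_linear:
  assumes "open S" "bounded_linear l" "Ck_on k S f"
  shows "Ck_on k S (\<lambda>x. l (f x))"
  using assms(3)
proof (induction k arbitrary: f)
  case 0
  then show ?case using assms(2) by (simp add: bounded_linear.continuous_on)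
next
  case (Suc k)
  have d: "((\<lambda>x. l (f x)) has_derivative (\<lambda>v. l (frechet_derivative f (at x) v))) (at x)" if "x \<in> S" for x
    using Suc.prems that
    by (intro bounded_linear.has_derivative[OF assms(2)]) (simp add: frechet_derivative_works[symmetric])
  have "Ck_on k S (\<lambda>x. frechet_derivative (\<lambda>x. l (f x)) (at x) v)" for v
  proof (rule Ck_on_cong[OF assms(1)])
    show "Ck_on k S (\<lambda>x. l (frechet_derivative f (at x) v))" using Suc by simp
  qed (simp add: frechet_derivative_at[OF d, symmetric])
  then show ?case using d by (auto simp: differentiable_def)
qed

lemma Ck_on_add:
  assumes "open S" "Ck_on k S f" "Ck_on k S g"
  shows "Ck_on k S (\<lambda>x. f x + g x)"
  using assms(2,3)
proof (induction k arbitrary: f g)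
  case 0
  then show ?case by (simp add: continuous_on_add)
next
  case (Suc k)
  have d: "((\<lambda>x. f x + g x) has_derivative
      (\<lambda>v. frechet_derivative f (at x) v + frechet_derivative g (at x) v)) (at x)" if "x \<in> S" for x
    using Suc.prems that
    by (intro has_derivative_add) (simp_all add: frechet_derivative_works[symmetric])
  have "Ck_on k S (\<lambda>x. frechet_derivative (\<lambda>x. f x + g x) (at x) v)" for v
  proof (rule Ck_on_cong[OF assms(1)])
    show "Ck_on k S (\<lambda>x. frechet_derivative f (at x) v + frechet_derivative g (at x) v)"
      using Suc by simp
  qed (simp add: frechet_derivative_at[OF d, symmetric])
  then show ?case using d by (auto simp: differentiable_def)
qed

lemma Ck_on_sum:
  assumes "open S" "\<And>i. i \<in> I \<Longrightarrow> Ck_on k S (f i)"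
  shows "Ck_on k S (\<lambda>x. \<Sum>i\<in>I. f i x)"
  using assms(2)
  by (induction I rule: infinite_finite_induct) (auto intro: Ck_on_const Ck_on_add assms(1))

lemma Ck_on_scaleR:
  fixes f :: "'a::real_normed_vector \<Rightarrow> real" and g :: "'a \<Rightarrow> 'b::real_normed_vector"
  assumes "open S" "Ck_on k S f" "Ck_on k S g"
  shows "Ck_on k S (\<lambda>x. f x *\<^sub>R g x)"
  using assms(2,3)
proof (induction k arbitrary: f g)
  case 0
  then show ?case by (simp add: continuous_on_scaleR)
next
  case (Suc k)
  have d: "((\<lambda>x. f x *\<^sub>R g x) has_derivative
      (\<lambda>v. f x *\<^sub>R frechet_derivative g (at x) v + frechet_derivative f (at x) v *\<^sub>R g x)) (at x)"
    if "x \<in> S" for x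
    using Suc.prems that
    by (intro has_derivative_scaleR) (simp_all add: frechet_derivative_works[symmetric])
  have "Ck_on k S (\<lambda>x. frechet_derivative (\<lambda>x. f x *\<^sub>R g x) (at x) v)" for v
  proof (rule Ck_on_cong[OF assms(1)])
    show "Ck_on k S (\<lambda>x. f x *\<^sub>R frechet_derivative g (at x) v + frechet_derivative f (at x) v *\<^sub>R g x)"
      using Suc.prems Suc.prems[THEN Ck_on_SucD] by (intro Ck_on_add[OF assms(1)] Suc.IH) simp_all
  qed (simp add: frechet_derivative_at[OF d, symmetric])
  then show ?case using d by (auto simp: differentiable_def)
qed

lemma frechet_derivative_basis_sum:
  fixes f :: "'a::euclidean_space \<Rightarrow> 'b::real_normed_vector"
  assumes "f differentiable (at x)"
  shows "frechet_derivative f (at x) v = (\<Sum>b\<in>Basis. (v \<bullet> b) *\<^sub>R frechet_derivative f (at x) b)"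
proof -
  interpret linear "frechet_derivative f (at x)" by (rule linear_frechet_derivative[OF assms])
  have "frechet_derivative f (at x) (\<Sum>b\<in>Basis. (v \<bullet> b) *\<^sub>R b) = (\<Sum>b\<in>Basis. (v \<bullet> b) *\<^sub>R frechet_derivative f (at x) b)"
    by (simp add: sum scaleR)
  then show ?thesis by (simp only: euclidean_representation)
qed

text \<open>By the chain rule, a directional derivative of \<open>f \<circ> g\<close> is a sum over a basis of products of a
  component of a directional derivative of \<open>g\<close> and a partial derivative of \<open>f\<close> composed with \<open>g\<close>. The
  factors are one degree less smooth, so induction applies to them.\<close>

lemma Ck_on_compose:
  fixes f :: "'b::euclidean_space \<Rightarrow> 'c::real_normed_vector" and g :: "'a::real_normed_vector \<Rightarrow> 'b"
  assumes "open S" "open T" "g ` S \<subseteq> T" "Ck_on k T f" "Ck_on k S g"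
  shows "Ck_on k S (\<lambda>x. f (g x))"
  using assms(3-5)
proof (induction k arbitrary: f g)
  case 0
  then show ?case by (auto intro: continuous_on_compose2)
next
  case (Suc k)
  have d: "((\<lambda>x. f (g x)) has_derivative
      (\<lambda>v. frechet_derivative f (at (g x)) (frechet_derivative g (at x) v))) (at x)" if "x \<in> S" for x
  proof -
    have "(g has_derivative frechet_derivative g (at x)) (at x)"
      using Suc.prems(3) that by (simp add: frechet_derivative_works[symmetric])
    have "g x \<in> T" using Suc.prems(1) that by auto
    then have "(f has_derivative frechet_derivative f (at (g x))) (at (g x))"
      using Suc.prems(2) by (simp add: frechet_derivative_works[symmetric])
    with \<open>(g has_derivative _) _\<close> show ?thesis by (rule has_derivative_compose)
  qed
  have "Ck_on k S (\<lambda>x. frechet_derivative (\<lambda>x. f (g x)) (at x) v)" for v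
  proof (rule Ck_on_cong[OF assms(1)])
    show "Ck_on k S (\<lambda>x. \<Sum>b\<in>Basis. (frechet_derivative g (at x) v \<bullet> b) *\<^sub>R frechet_derivative f (at (g x)) b)"
    proof (rule Ck_on_sum[OF assms(1)], rule Ck_on_scaleR[OF assms(1)])
      fix b :: 'b
      show "Ck_on k S (\<lambda>x. frechet_derivative g (at x) v \<bullet> b)"
        using Suc.prems(3) by (intro Ck_on_bounded_linear[OF assms(1) bounded_linear_inner_left]) simp
      show "Ck_on k S (\<lambda>x. frechet_derivative f (at (g x)) b)"
        using Suc.prems(2) by (intro Suc.IH[OF Suc.prems(1) _ Ck_on_SucD[OF Suc.prems(3)]]) simp
    qed
    show "(\<Sum>b\<in>Basis. (frechet_derivative g (at x) v \<bullet> b) *\<^sub>R frechet_derivative f (at (g x)) b) =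
        frechet_derivative (\<lambda>x. f (g x)) (at x) v" if "x \<in> S" for x
      using Suc.prems that
      by (subst frechet_derivative_at[OF d, symmetric])
        (auto simp: image_subset_iff intro!: frechet_derivative_basis_sum[symmetric])
  qed
  then show ?case using d by (auto simp: differentiable_def)
qed

lemma smooth_on_subset: "smooth_on T f \<Longrightarrow> S \<subseteq> T \<Longrightarrow> smooth_on S f"
  by (auto simp: smooth_on_def intro: Ck_on_subset)

lemma smooth_on_cong:
  "open S \<Longrightarrow> (\<And>x. x \<in> S \<Longrightarrow> f x = g x) \<Longrightarrow> smooth_on S f \<Longrightarrow> smooth_on S g"
  by (auto simp: smooth_on_def intro: Ck_on_cong)

lemma smooth_on_compose:
  fixes f :: "'b::euclidean_space \<Rightarrow> 'c::real_normed_vector"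
  shows "open S \<Longrightarrow> open T \<Longrightarrow> g ` S \<subseteq> T \<Longrightarrow> smooth_on T f \<Longrightarrow> smooth_on S g \<Longrightarrow> smooth_on S (\<lambda>x. f (g x))"
  by (auto simp: smooth_on_def intro: Ck_on_compose)

lemma smooth_on_bounded_linear:
  "open S \<Longrightarrow> bounded_linear l \<Longrightarrow> smooth_on S f \<Longrightarrow> smooth_on S (\<lambda>x. l (f x))"
  by (auto simp: smooth_on_def intro: Ck_on_bounded_linear)

lemma smooth_on_scaleR:
  "open S \<Longrightarrow> smooth_on S f \<Longrightarrow> smooth_on S g \<Longrightarrow> smooth_on S (\<lambda>x. f x *\<^sub>R g x)"
  by (auto simp: smooth_on_def intro: Ck_on_scaleR)

lemma smooth_on_continuous_on: "smooth_on S f \<Longrightarrow> continuous_on S f"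
  by (meson smooth_on_def Ck_on.simps(1))

lemma smooth_on_differentiable: "smooth_on S f \<Longrightarrow> x \<in> S \<Longrightarrow> f differentiable (at x)"
  by (meson smooth_on_def Ck_on.simps(2))

lemma smooth_on_has_derivative:
  "smooth_on S f \<Longrightarrow> x \<in> S \<Longrightarrow> (f has_derivative frechet_derivative f (at x)) (at x)"
  using smooth_on_differentiable frechet_derivative_works by blast

lemma smooth_on_directional: "smooth_on S f \<Longrightarrow> smooth_on S (\<lambda>x. frechet_derivative f (at x) v)"
  unfolding smooth_on_def using Ck_on.simps(2) by blast

lemma smooth_on_partial_derivatives:
  assumes G: "smooth_on R G" and z: "(m, t) \<in> R"
  shows "((\<lambda>r. G (r, t)) has_vector_derivative frechet_derivative G (at (m, t)) (1, 0)) (at m within I)"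
    and "((\<lambda>r. G (m, r)) has_vector_derivative frechet_derivative G (at (m, t)) (0, 1)) (at t within I)"
proof -
  have D: "(G has_derivative frechet_derivative G (at (m, t))) (at (m, t))"
    by (rule smooth_on_has_derivative[OF G z])
  note lin = linear_cmul[OF bounded_linear.linear[OF has_derivative_bounded_linear[OF D]], symmetric]
  have "((\<lambda>r. (r, t)) has_derivative (\<lambda>h. (h, 0))) (at m within I)"
    by (auto intro!: derivative_eq_intros)
  from has_derivative_compose[OF this D]
  show "((\<lambda>r. G (r, t)) has_vector_derivative frechet_derivative G (at (m, t)) (1, 0)) (at m within I)"
    by (simp add: has_vector_derivative_def lin)
  have "((\<lambda>r. (m, r)) has_derivative (\<lambda>h. (0, h))) (at t within I)"
    by (auto intro!: derivative_eq_intros)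
  from has_derivative_compose[OF this D]
  show "((\<lambda>r. G (m, r)) has_vector_derivative frechet_derivative G (at (m, t)) (0, 1)) (at t within I)"
    by (simp add: has_vector_derivative_def lin)
qed

section \<open>Linear differential equations on short intervals\<close>

lemma has_vector_derivative_transform_eventually:
  assumes "(f has_vector_derivative D) (at x within S)" "\<forall>\<^sub>F y in at x within S. f y = g y"
    "f x = g x" "x \<in> S"
  shows "(g has_vector_derivative D) (at x within S)"
  using assms unfolding has_vector_derivative_def by (rule has_derivative_transform_eventually)

lemma at_within_Icc_nontrivial:
  fixes a b :: real
  assumes "a < b" "s \<in> {a..b}" shows "at s within {a..b} \<noteq> bot"
  using assms trivial_limit_within[of s "{a..b}"] islimpt_Icc[of a b s] by simp

lemma tendsto_component:
  fixes l :: "'a \<Rightarrow> 'b::topological_space"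
  assumes "(f \<longlongrightarrow> l) \<F>" shows "((\<lambda>h. f h i) \<longlongrightarrow> l i) \<F>"
  by (rule continuous_on_tendsto_compose[OF continuous_on_product_coordinates assms]) simp_all

text \<open>The mean value inequality, for increments up to the right end, where the data of the
  differential equations below are prescribed.\<close>

lemma norm_increment_le:
  fixes W :: "real \<Rightarrow> 'a::real_normed_vector"
  assumes "\<And>s. s \<in> {a..b} \<Longrightarrow> (W has_vector_derivative W' s) (at s within {a..b})"
    and "\<And>s. s \<in> {a..b} \<Longrightarrow> norm (W' s) \<le> C"
    and "s \<in> {a..b}"
  shows "norm (W b - W s) \<le> C * (b - s)"
proof -
  have "norm (W b - W s) \<le> C * norm (b - s)"
  proof (rule differentiable_bound[where S="{a..b}" and f'="\<lambda>s x. x *\<^sub>R W' s"])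
    fix x assume x: "x \<in> {a..b}"
    show "(W has_derivative (\<lambda>h. h *\<^sub>R W' x)) (at x within {a..b})"
      using assms(1)[OF x] by (simp add: has_vector_derivative_def)
    show "onorm (\<lambda>h. h *\<^sub>R W' x) \<le> C"
      using assms(2)[OF x] by (intro onorm_le) (simp add: mult.commute[of C] mult_left_mono)
  qed (use assms(3) in auto)
  then show ?thesis using assms(3) by simp
qed

text \<open>At a point where the difference \<open>D\<close> of two solutions has its maximal norm, the mean value
  inequality bounds that maximum by \<open>K (b - a) < 1\<close> times itself, because \<open>D\<close> vanishes at \<open>b\<close>.\<close>

lemma short_ode_unique:
  fixes f :: "real \<Rightarrow> 'a::real_normed_vector \<Rightarrow> 'a"
  assumes lip: "\<And>s x y. s \<in> {a..b} \<Longrightarrow> norm (f s x - f s y) \<le> K * norm (x - y)"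
    and short: "K * (b - a) < 1" and K: "0 \<le> K"
    and V: "\<And>s. s \<in> {a..b} \<Longrightarrow> (V has_vector_derivative f s (V s)) (at s within {a..b})"
    and W: "\<And>s. s \<in> {a..b} \<Longrightarrow> (W has_vector_derivative f s (W s)) (at s within {a..b})"
    and end_eq: "V b = W b" and s: "s \<in> {a..b}"
  shows "V s = W s"
proof -
  define D where "D = (\<lambda>s. V s - W s)"
  have D': "(D has_vector_derivative f s (V s) - f s (W s)) (at s within {a..b})" if "s \<in> {a..b}" for s
    unfolding D_def by (intro has_vector_derivative_diff V W that)
  have "continuous_on {a..b} (\<lambda>s. norm (D s))"
    by (intro continuous_on_norm continuous_on_vector_derivative[OF D'])
  then obtain s0 where s0: "s0 \<in> {a..b}" and max: "\<And>s. s \<in> {a..b} \<Longrightarrow> norm (D s) \<le> norm (D s0)"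
    using continuous_attains_sup[of "{a..b}" "\<lambda>s. norm (D s)"] s by auto
  have "norm (D b - D s0) \<le> (K * norm (D s0)) * (b - s0)"
  proof (rule norm_increment_le[OF D' _ s0])
    fix r assume r: "r \<in> {a..b}"
    have "norm (f r (V r) - f r (W r)) \<le> K * norm (D r)"
      using lip[OF r] by (simp add: D_def)
    also have "\<dots> \<le> K * norm (D s0)" using max[OF r] K by (rule mult_left_mono)
    finally show "norm (f r (V r) - f r (W r)) \<le> K * norm (D s0)" .
  qed
  also have "\<dots> \<le> (K * norm (D s0)) * (b - a)"
    using s0 K by (intro mult_left_mono) auto
  finally have "norm (D s0) \<le> (K * (b - a)) * norm (D s0)"
    using end_eq by (simp add: D_def mult_ac norm_minus_commute)
  then have "norm (D s0) = 0"
    using short by (smt (verit) mult_le_cancel_right1 norm_ge_zero)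
  then show ?thesis using max[OF s] by (simp add: D_def)
qed

text \<open>The solution with value \<open>w\<close> at the right end is the fixed point of
  \<open>W \<mapsto> (\<lambda>s. w - \<integral>\<^bsub>s..b\<^esub> f r (W r) dr)\<close>, which contracts the supremum norm by the factor \<open>K (b - a)\<close>.\<close>

lemma short_ode_exists:
  fixes f :: "real \<Rightarrow> 'a::euclidean_space \<Rightarrow> 'a"
  assumes ab: "a \<le> b"
    and cont: "continuous_on ({a..b} \<times> UNIV) (\<lambda>(s, x). f s x)"
    and lip: "\<And>s x y. s \<in> {a..b} \<Longrightarrow> norm (f s x - f s y) \<le> K * norm (x - y)"
    and short: "K * (b - a) < 1" and K: "0 \<le> K"
  obtains W where "W b = w"
    and "\<And>s. s \<in> {a..b} \<Longrightarrow> (W has_vector_derivative f s (W s)) (at s within {a..b})"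
proof -
  let ?P = "\<lambda>W s. w - integral {s..b} (\<lambda>r. f r (W r))"
  have contf: "continuous_on {a..b} (\<lambda>r. f r (W r))" if "continuous_on {a..b} W" for W
    using continuous_on_compose2[OF cont continuous_on_Pair[OF continuous_on_id that]] by auto
  have intf: "(\<lambda>r. f r (W r)) integrable_on {s..b}" if "continuous_on {a..b} W" "s \<in> {a..b}" for W s
    using that by (intro integrable_continuous_real continuous_on_subset[OF contf]) auto
  have Pder: "((\<lambda>s. w - integral {s..b} (\<lambda>r. f r (W r))) has_vector_derivative f s (W s)) (at s within {a..b})"
    if W: "continuous_on {a..b} W" and s: "s \<in> {a..b}" for W s
  proof -
    let ?F = "\<lambda>r. f r (W r)"
    have eq: "w - integral {a..b} ?F + integral {a..r} ?F = w - integral {r..b} ?F" if r: "r \<in> {a..b}" for r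
    proof -
      have "integral {a..r} ?F + integral {r..b} ?F = integral {a..b} ?F"
        using r ab by (intro Henstock_Kurzweil_Integration.integral_combine intf[OF W]) auto
      then show ?thesis by (simp add: algebra_simps)
    qed
    have "((\<lambda>r. (w - integral {a..b} ?F) + integral {a..r} ?F)
        has_vector_derivative 0 + f s (W s)) (at s within {a..b})"
      by (intro has_vector_derivative_add has_vector_derivative_const
          integral_has_vector_derivative contf W s)
    then have "((\<lambda>r. (w - integral {a..b} ?F) + integral {a..r} ?F)
        has_vector_derivative f s (W s)) (at s within {a..b})" by simp
    then show ?thesis
      by (rule has_vector_derivative_transform[OF s, rotated]) (rule eq[symmetric])
  qed
  \<comment> \<open>Clamping the argument extends functions on \<open>{a..b}\<close> to the line, so that the operator acts on a
    complete space of bounded continuous functions.\<close>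
  define Q :: "(real \<Rightarrow>\<^sub>C 'a) \<Rightarrow> (real \<Rightarrow>\<^sub>C 'a)"
    where "Q W = Bcontfun (\<lambda>s. ?P W (clamp a b s))" for W
  have contW: "continuous_on {a..b} (apply_bcontfun W)" for W :: "real \<Rightarrow>\<^sub>C 'a"
    by (rule continuous_on_apply_bcontfun)
  have Qapp: "apply_bcontfun (Q W) = (\<lambda>s. ?P W (clamp a b s))" for W :: "real \<Rightarrow>\<^sub>C 'a"
  proof -
    have c: "continuous_on (cbox a b) (?P W)"
      unfolding cbox_interval by (rule continuous_on_vector_derivative[OF Pder[OF contW]])
    have "continuous_on UNIV (\<lambda>s. ?P W (clamp a b s))"
      using clamp_continuous_on[OF c] by simp
    moreover have "bounded (range (\<lambda>s. ?P W (clamp a b s)))"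
      using clamp_bounded[OF compact_imp_bounded[OF compact_continuous_image[OF c compact_cbox]]] by simp
    ultimately show ?thesis unfolding Q_def by (intro Bcontfun_inverse) (simp add: bcontfun_def)
  qed
  have contr: "dist (Q V) (Q W) \<le> (K * (b - a)) * dist V W" for V W
  proof (rule dist_bound)
    fix s
    let ?s = "clamp a b s"
    have s: "?s \<in> {a..b}" using clamp_in_interval[of a b s] ab by simp
    have "Q V s - Q W s = - integral {?s..b} (\<lambda>r. f r (V r) - f r (W r))"
      using intf[OF contW s, of V] intf[OF contW s, of W] by (simp add: Qapp Henstock_Kurzweil_Integration.integral_diff)
    then have "dist (Q V s) (Q W s) = norm (integral {?s..b} (\<lambda>r. f r (V r) - f r (W r)))"
      by (simp add: dist_norm norm_minus_commute)
    also have "\<dots> \<le> (K * dist V W) * (b - ?s)"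
    proof (rule integral_bound)
      show "?s \<le> b" using s by simp
      show "continuous_on {?s..b} (\<lambda>r. f r (V r) - f r (W r))"
        using s by (intro continuous_on_subset[OF continuous_on_diff[OF contf contf]] contW) auto
      fix r assume r: "r \<in> {?s..b}"
      have "norm (f r (V r) - f r (W r)) \<le> K * norm (V r - W r)"
        using r s by (intro lip) auto
      also have "\<dots> \<le> K * dist V W"
        using dist_bounded[of V r W] K by (intro mult_left_mono) (simp_all add: dist_norm)
      finally show "norm (f r (V r) - f r (W r)) \<le> K * dist V W" .
    qed
    also have "\<dots> \<le> (K * dist V W) * (b - a)"
      using s K by (intro mult_left_mono) auto
    finally show "dist (Q V s) (Q W s) \<le> (K * (b - a)) * dist V W" by (simp add: mult_ac)
  qed
  obtain W where "Q W = W"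
    using banach_fix_type[of "K * (b - a)" Q] contr short K ab by auto
  then have fix_eq: "W s = ?P W s" if "s \<in> {a..b}" for s
    using Qapp[of W] that by (metis box_real(2) clamp_cancel_cbox)
  show ?thesis
  proof (rule that)
    show "apply_bcontfun W b = w" using fix_eq[of b] ab by simp
    fix s assume s: "s \<in> {a..b}"
    show "(apply_bcontfun W has_vector_derivative f s (W s)) (at s within {a..b})"
      by (rule has_vector_derivative_transform[OF s _ Pder[OF contW s]]) (use fix_eq in auto)
  qed
qed

text \<open>Here \<open>W h\<close> is the solution on \<open>{a..a + h}\<close> that agrees with \<open>V\<close> at the right end. Growth at most
  linear forces \<open>W h\<close> to stay close to its end value when \<open>h\<close> is small, hence close to \<open>V a\<close>. Then
  \<open>W h - V\<close>, which vanishes at \<open>a + h\<close>, has a derivative close to \<open>f a (V a) - V' a\<close> throughout.\<close>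

lemma transport_difference_quotient:
  fixes f :: "real \<Rightarrow> 'a::real_normed_vector \<Rightarrow> 'a" and W :: "real \<Rightarrow> real \<Rightarrow> 'a"
  assumes ab: "a < b"
    and cont: "continuous_on ({a..b} \<times> UNIV) (\<lambda>(s, x). f s x)"
    and bound: "\<And>s x. s \<in> {a..b} \<Longrightarrow> norm (f s x) \<le> K * norm x" and K: "0 \<le> K"
    and V: "\<And>s. s \<in> {a..b} \<Longrightarrow> (V has_vector_derivative V' s) (at s within {a..b})"
    and V': "continuous_on {a..b} V'"
    and W: "\<forall>\<^sub>F h in at_right 0. W h (a + h) = V (a + h) \<and>
      (\<forall>s\<in>{a..a+h}. (W h has_vector_derivative f s (W h s)) (at s within {a..a+h}))"
  shows "((\<lambda>h. (1 / h) *\<^sub>R (W h a - V a)) \<longlongrightarrow> V' a - f a (V a)) (at_right 0)"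
proof (rule tendstoI)
  fix e :: real assume e: "e > 0"
  have Vc: "continuous_on {a..b} V" by (rule continuous_on_vector_derivative[OF V])
  obtain M where M: "M > 0" "\<And>s. s \<in> {a..b} \<Longrightarrow> norm (V s) \<le> M"
  proof -
    have "bounded (V ` {a..b})"
      using Vc by (intro compact_imp_bounded compact_continuous_image) auto
    then show ?thesis using that unfolding bounded_pos by auto
  qed
  have "continuous (at (a, V a) within {a..b} \<times> UNIV) (\<lambda>(s, x). f s x)"
    using cont ab by (simp add: continuous_on_eq_continuous_within)
  then obtain d1 where d1: "d1 > 0" and
    fd: "\<And>s x. s \<in> {a..b} \<Longrightarrow> dist (s, x) (a, V a) < d1 \<Longrightarrow> dist (f s x) (f a (V a)) < e / 4"
    using e unfolding continuous_within_eps_delta by (elim allE[of _ "e/4"]) auto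
  have "continuous (at a within {a..b}) V'"
    using V' ab by (simp add: continuous_on_eq_continuous_within)
  then obtain d2 where d2: "d2 > 0" and
    V'd: "\<And>s. s \<in> {a..b} \<Longrightarrow> dist s a < d2 \<Longrightarrow> dist (V' s) (V' a) < e / 4"
    using e unfolding continuous_within_eps_delta by (elim allE[of _ "e/4"]) auto
  have "continuous (at a within {a..b}) V"
    using Vc ab by (simp add: continuous_on_eq_continuous_within)
  then obtain d3 where d3: "d3 > 0" and
    Vd: "\<And>s. s \<in> {a..b} \<Longrightarrow> dist s a < d3 \<Longrightarrow> dist (V s) (V a) < d1 / 4"
    using d1 unfolding continuous_within_eps_delta by (elim allE[of _ "d1/4"]) auto
  \<comment> \<open>For \<open>h < r\<close>, the bound \<open>1 / (2 (K + 1))\<close> makes the solutions at most \<open>2 M\<close> in norm, the bound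
    involving \<open>N\<close> keeps them within \<open>d1 / 4\<close> of their end values, and the other bounds put all points
    within the radii of continuity of \<open>f\<close>, \<open>V'\<close> and \<open>V\<close> at \<open>a\<close>.\<close>
  define N where "N = (K + 1) * M"
  have N: "N > 0" "K * M < N" unfolding N_def using K M(1) by simp_all
  define r where "r = Min {b - a, 1 / (2 * (K + 1)), d1 / (8 * N), d1 / 4, d2, d3}"
  have r: "r > 0" "r \<le> b - a" "r \<le> 1 / (2 * (K + 1))" "r \<le> d1 / (8 * N)"
    "r \<le> d1 / 4" "r \<le> d2" "r \<le> d3"
  proof -
    show "r > 0" unfolding r_def using ab K N d1 d2 d3 by simp
  qed (auto simp only: r_def intro!: Min_le)
  have ev: "\<forall>\<^sub>F h in at_right 0. 0 < h \<and> h < r"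
    using r(1) unfolding eventually_at_right_field by (intro exI[of _ r]) auto
  from ev W show "\<forall>\<^sub>F h in at_right 0. dist ((1 / h) *\<^sub>R (W h a - V a)) (V' a - f a (V a)) < e"
  proof eventually_elim
    case (elim h)
    then have h: "0 < h" "h < r" and We: "W h (a + h) = V (a + h)"
      and Wd: "\<And>s. s \<in> {a..a+h} \<Longrightarrow> (W h has_vector_derivative f s (W h s)) (at s within {a..a+h})"
      by auto
    have sub: "{a..a+h} \<subseteq> {a..b}" using h r by auto
    have "continuous_on {a..a+h} (\<lambda>s. norm (W h s))"
      by (intro continuous_on_norm continuous_on_vector_derivative[OF Wd])
    then obtain s0 where s0: "s0 \<in> {a..a+h}"
      and max: "\<And>s. s \<in> {a..a+h} \<Longrightarrow> norm (W h s) \<le> norm (W h s0)"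
      using continuous_attains_sup[of "{a..a+h}" "\<lambda>s. norm (W h s)"] h by auto
    have Wb: "norm (W h (a + h) - W h s) \<le> K * norm (W h s0) * h" if s: "s \<in> {a..a+h}" for s
    proof -
      have "norm (W h (a + h) - W h s) \<le> (K * norm (W h s0)) * (a + h - s)"
      proof (rule norm_increment_le[OF Wd _ s])
        fix x assume x: "x \<in> {a..a+h}"
        have "norm (f x (W h x)) \<le> K * norm (W h x)" using bound x sub by auto
        also have "\<dots> \<le> K * norm (W h s0)" using max[OF x] K by (rule mult_left_mono)
        finally show "norm (f x (W h x)) \<le> K * norm (W h s0)" .
      qed
      also have "\<dots> \<le> K * norm (W h s0) * h" using s K by (intro mult_left_mono) auto
      finally show ?thesis .
    qed
    have Kh: "(K + 1) * h \<le> 1 / 2"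
    proof -
      have "(K + 1) * h \<le> (K + 1) * (1 / (2 * (K + 1)))" using h r K by (intro mult_left_mono) auto
      also have "\<dots> = 1 / 2" using K by (simp add: field_simps)
      finally show ?thesis .
    qed
    have "norm (W h s0) \<le> norm (W h (a + h)) + K * norm (W h s0) * h"
      using Wb[OF s0] norm_triangle_sub[of "W h s0" "W h (a + h)"] by (simp add: norm_minus_commute)
    also have "K * norm (W h s0) * h = (K * h) * norm (W h s0)" by simp
    also have "\<dots> \<le> 1 / 2 * norm (W h s0)"
      using Kh h by (intro mult_right_mono) (auto simp: algebra_simps)
    finally have W0: "norm (W h s0) \<le> 2 * M"
      using M(2)[of "a + h"] We h r by auto
    have near: "dist (W h s) (V a) < d1 / 2" if s: "s \<in> {a..a+h}" for s
    proof -
      have "norm (W h (a + h) - W h s) \<le> K * (2 * M) * h"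
        using Wb[OF s] mult_right_mono[OF mult_left_mono[OF W0 K], of h] h by simp
      also have "\<dots> \<le> 2 * N * h" using N h by simp
      also have "\<dots> < 2 * N * (d1 / (8 * N))"
        using h r N by (intro mult_strict_left_mono) auto
      also have "\<dots> = d1 / 4" using N by simp
      finally have "dist (W h s) (V (a + h)) < d1 / 4"
        using We by (simp add: dist_norm norm_minus_commute)
      moreover have "dist (V (a + h)) (V a) < d1 / 4"
        using h r by (intro Vd) (auto simp: dist_norm)
      ultimately show ?thesis using dist_triangle[of "W h s" "V a" "V (a + h)"] by linarith
    qed
    \<comment> \<open>Subtracting the linear function with the expected slope leaves a function with small derivative.\<close>
    define G where "G = (\<lambda>s. W h s - V s - (s - a) *\<^sub>R (f a (V a) - V' a))"
    have G': "(G has_vector_derivative (f s (W h s) - V' s - (f a (V a) - V' a))) (at s within {a..a+h})"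
      if s: "s \<in> {a..a+h}" for s
    proof -
      have "((\<lambda>s. (s - a) *\<^sub>R (f a (V a) - V' a)) has_vector_derivative (f a (V a) - V' a)) (at s within {a..a+h})"
        unfolding has_vector_derivative_def by (auto intro!: derivative_eq_intros)
      moreover have "(V has_vector_derivative V' s) (at s within {a..a+h})"
        using V sub s by (meson has_vector_derivative_within_subset subsetD)
      ultimately show ?thesis unfolding G_def
        using Wd[OF s] by (intro has_vector_derivative_diff) auto
    qed
    have "norm (G (a + h) - G a) \<le> (e / 2) * (a + h - a)"
    proof (rule norm_increment_le[OF G'])
      fix s assume s: "s \<in> {a..a+h}"
      have "dist (s, W h s) (a, V a) \<le> dist s a + dist (W h s) (V a)"
        unfolding dist_Pair_Pair using sqrt_sum_squares_le_sum_abs[of "dist s a" "dist (W h s) (V a)"] by simp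
      also have "dist s a < d1 / 4" using s h r by (auto simp: dist_norm)
      finally have "dist (s, W h s) (a, V a) < d1" using near[OF s] d1 by simp
      then have "norm (f s (W h s) - f a (V a)) < e / 4"
        using s sub by (fold dist_norm, intro fd) auto
      moreover have "norm (V' s - V' a) < e / 4"
        using s sub h r by (fold dist_norm, intro V'd) (auto simp: dist_norm)
      moreover have "norm ((f s (W h s) - f a (V a)) - (V' s - V' a))
          \<le> norm (f s (W h s) - f a (V a)) + norm (V' s - V' a)"
        by (rule norm_triangle_ineq4)
      moreover have "norm (f s (W h s) - V' s - (f a (V a) - V' a)) = norm ((f s (W h s) - f a (V a)) - (V' s - V' a))"
        by (rule arg_cong[where f = norm]) (simp add: algebra_simps)
      ultimately show "norm (f s (W h s) - V' s - (f a (V a) - V' a)) \<le> e / 2"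
        by linarith
    qed (use h in auto)
    moreover have "G (a + h) - G a = - (W h a - V a - h *\<^sub>R (V' a - f a (V a)))"
      using We by (simp add: G_def algebra_simps)
    ultimately have "norm (W h a - V a - h *\<^sub>R (V' a - f a (V a))) \<le> (e / 2) * h"
      by (simp only: norm_minus_cancel add_diff_cancel_left')
    moreover have "(1 / h) *\<^sub>R (W h a - V a) - (V' a - f a (V a))
        = (1 / h) *\<^sub>R (W h a - V a - h *\<^sub>R (V' a - f a (V a)))"
      using h by (simp add: scaleR_diff_right)
    then have "dist ((1 / h) *\<^sub>R (W h a - V a)) (V' a - f a (V a))
        = (1 / h) * norm (W h a - V a - h *\<^sub>R (V' a - f a (V a)))"
      using h unfolding dist_norm by (simp only: norm_scaleR)  simp
    ultimately have "dist ((1 / h) *\<^sub>R (W h a - V a)) (V' a - f a (V a)) \<le> (1 / h) * ((e / 2) * h)"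
      using h by (simp only:) (intro mult_left_mono, auto)
    then have "dist ((1 / h) *\<^sub>R (W h a - V a)) (V' a - f a (V a)) \<le> e / 2"
      using h by simp
    then show ?case using e by simp
  qed
qed

section \<open>Tangent vectors in charts\<close>

text \<open>A tangent vector at \<open>p\<close> is determined by its component in one chart, which can be any vector of the
  plane.\<close>

definition tangent_of :: "'p chart set \<Rightarrow> 'p chart \<Rightarrow> 'p \<Rightarrow> real ^ 2 \<Rightarrow> 'p tangent" where
  "tangent_of A c p \<xi> = (\<lambda>d. if d \<in> charts_at A p
     then frechet_derivative (cmap d \<circ> cinv c) (at (cmap c p)) \<xi> else 0)"

lemma coord_field_eq_tangent_of: "coord_field A c j p = tangent_of A c p (axis j 1)"
  by (simp add: coord_field_def tangent_of_def)

locale smooth_atlas =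
  fixes X :: "'p topology" and A :: "'p chart set"
  assumes surface: "smooth_surface X A"
begin

lemma cdom_open: "c \<in> A \<Longrightarrow> openin X (cdom c)"
  using surface by (auto simp: smooth_surface_def)

lemma chart_homeomorphic:
  "c \<in> A \<Longrightarrow> homeomorphic_map (subtopology X (cdom c)) (top_of_set (cmap c ` cdom c)) (cmap c)"
  using surface by (auto simp: smooth_surface_def)

lemma chart_inj: assumes "c \<in> A" shows "inj_on (cmap c) (cdom c)"
proof -
  have "topspace (subtopology X (cdom c)) = cdom c"
    using cdom_open[OF assms] openin_subset by fastforce
  then show ?thesis
    using homeomorphic_imp_injective_map[OF chart_homeomorphic[OF assms]] by simp
qed

lemma cinv_cmap: "c \<in> A \<Longrightarrow> p \<in> cdom c \<Longrightarrow> cinv c (cmap c p) = p"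
  by (simp add: chart_inj)

lemma open_chart_image:
  assumes c: "c \<in> A" and U: "openin X U"
  shows "open (cmap c ` (U \<inter> cdom c))"
proof -
  have "openin (top_of_set (cmap c ` cdom c)) (cmap c ` (U \<inter> cdom c))"
    using homeomorphic_imp_open_map[OF chart_homeomorphic[OF c]] U
    unfolding open_map_def by (auto simp: openin_subtopology)
  moreover have "open (cmap c ` cdom c)" using surface c by (auto simp: smooth_surface_def)
  ultimately show ?thesis using openin_open_trans by blast
qed

lemma open_overlap: "c \<in> A \<Longrightarrow> d \<in> A \<Longrightarrow> open (cmap c ` (cdom c \<inter> cdom d))"
  using open_chart_image[of c "cdom d"] cdom_open[of d] by (simp add: Int_commute)

lemma transition_smooth:
  "c \<in> A \<Longrightarrow> d \<in> A \<Longrightarrow> smooth_on (cmap c ` (cdom c \<inter> cdom d)) (cmap d \<circ> cinv c)"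
  using surface by (auto simp: smooth_surface_def)

lemma transition_has_derivative:
  assumes "c \<in> charts_at A p" "d \<in> charts_at A p"
  shows "((cmap d \<circ> cinv c) has_derivative frechet_derivative (cmap d \<circ> cinv c) (at (cmap c p)))
    (at (cmap c p))"
  using assms by (intro smooth_on_has_derivative[OF transition_smooth]) (auto simp: charts_at_def)

lemma transition_derivative_self:
  assumes "c \<in> charts_at A p"
  shows "frechet_derivative (cmap c \<circ> cinv c) (at (cmap c p)) v = v"
proof -
  have "frechet_derivative (cmap c \<circ> cinv c) (at (cmap c p)) = frechet_derivative (\<lambda>x. x) (at (cmap c p))"
    using assms open_overlap[of c c] cinv_cmap
    by (intro frechet_derivative_cong_open[of "cmap c ` cdom c"]) (auto simp: charts_at_def)
  then show ?thesis by (simp add: frechet_derivative_at[OF has_derivative_ident, symmetric])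
qed

text \<open>The cocycle condition for the Jacobians of the coordinate changes; it makes every choice of a
  component in one chart extend to a tangent vector.\<close>

lemma transition_derivative_compose:
  assumes c: "c \<in> charts_at A p" and d: "d \<in> charts_at A p" and e: "e \<in> charts_at A p"
  shows "frechet_derivative (cmap e \<circ> cinv d) (at (cmap d p))
      (frechet_derivative (cmap d \<circ> cinv c) (at (cmap c p)) v)
    = frechet_derivative (cmap e \<circ> cinv c) (at (cmap c p)) v"
proof -
  have A: "c \<in> A" "d \<in> A" "e \<in> A" and p: "p \<in> cdom c" "p \<in> cdom d" "p \<in> cdom e"
    using assms by (auto simp: charts_at_def)
  have "((cmap e \<circ> cinv d) has_derivative frechet_derivative (cmap e \<circ> cinv d) (at (cmap d p)))
      (at ((cmap d \<circ> cinv c) (cmap c p)))"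
    using transition_has_derivative[OF d e] A p cinv_cmap by simp
  from has_derivative_compose[OF transition_has_derivative[OF c d] this]
  have "((\<lambda>x. (cmap e \<circ> cinv d) ((cmap d \<circ> cinv c) x)) has_derivative
      (\<lambda>v. frechet_derivative (cmap e \<circ> cinv d) (at (cmap d p))
        (frechet_derivative (cmap d \<circ> cinv c) (at (cmap c p)) v))) (at (cmap c p))" .
  note frechet_derivative_at[OF this]
  moreover have "frechet_derivative (\<lambda>x. (cmap e \<circ> cinv d) ((cmap d \<circ> cinv c) x)) (at (cmap c p))
      = frechet_derivative (cmap e \<circ> cinv c) (at (cmap c p))"
    using A p cinv_cmap open_overlap[of c d]
    by (intro frechet_derivative_cong_open[of "cmap c ` (cdom c \<inter> cdom d)"]) auto
  ultimately show ?thesis by (metis (no_types))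
qed

lemma tangent_of_in_tangent_space:
  assumes "c \<in> charts_at A p" shows "tangent_of A c p \<xi> \<in> tangent_space A p"
  using assms transition_derivative_compose by (auto simp: tangent_space_def tangent_of_def)

lemma tangent_of_component: "c \<in> charts_at A p \<Longrightarrow> tangent_of A c p \<xi> c = \<xi>"
  by (simp add: tangent_of_def transition_derivative_self)

lemma tangent_component:
  assumes "v \<in> tangent_space A p" "c \<in> charts_at A p" "d \<in> charts_at A p"
  shows "v d = frechet_derivative (cmap d \<circ> cinv c) (at (cmap c p)) (v c)"
  using assms unfolding tangent_space_def by blast

lemma tangent_space_outside: "v \<in> tangent_space A p \<Longrightarrow> c \<notin> charts_at A p \<Longrightarrow> v c = 0"
  unfolding tangent_space_def by blast

lemma tangent_spaceI:
  assumes "\<And>c. c \<notin> charts_at A p \<Longrightarrow> v c = 0"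
    and "\<And>c d. c \<in> charts_at A p \<Longrightarrow> d \<in> charts_at A p \<Longrightarrow>
      v d = frechet_derivative (cmap d \<circ> cinv c) (at (cmap c p)) (v c)"
  shows "v \<in> tangent_space A p"
  using assms unfolding tangent_space_def by blast

lemma tangent_eq_tangent_of:
  assumes "v \<in> tangent_space A p" "c \<in> charts_at A p"
  shows "v = tangent_of A c p (v c)"
proof
  fix d show "v d = tangent_of A c p (v c) d"
  proof (cases "d \<in> charts_at A p")
    case True
    then show ?thesis using tangent_component[OF assms True] by (simp add: tangent_of_def)
  next
    case False
    then show ?thesis using tangent_space_outside[OF assms(1)] by (simp add: tangent_of_def)
  qed
qed

lemma bounded_linear_transition:
  assumes "c \<in> charts_at A p" "d \<in> charts_at A p"
  shows "bounded_linear (frechet_derivative (cmap d \<circ> cinv c) (at (cmap c p)))"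
  by (rule has_derivative_bounded_linear[OF transition_has_derivative[OF assms]])

lemma tangent_of_add: "c \<in> charts_at A p \<Longrightarrow>
    tangent_of A c p (\<xi> + \<eta>) = tangent_of A c p \<xi> + tangent_of A c p \<eta>"
  using linear_add[OF bounded_linear.linear[OF bounded_linear_transition]]
  by (auto simp: tangent_of_def fun_eq_iff)

lemma tangent_of_scaleR: "c \<in> charts_at A p \<Longrightarrow> tangent_of A c p (r *\<^sub>R \<xi>) = r *\<^sub>R tangent_of A c p \<xi>"
  using linear_cmul[OF bounded_linear.linear[OF bounded_linear_transition]]
  by (auto simp: tangent_of_def fun_eq_iff scaleR_fun_def)

lemma tangent_of_expand:
  assumes "c \<in> charts_at A p"
  shows "tangent_of A c p \<xi> = (\<xi> $ 1) *\<^sub>R tangent_of A c p (axis 1 1) + (\<xi> $ 2) *\<^sub>R tangent_of A c p (axis 2 1)"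
proof -
  have "\<xi> = (\<xi> $ 1) *\<^sub>R axis 1 1 + (\<xi> $ 2) *\<^sub>R axis 2 1"
    by (simp add: vec_eq_iff forall_2 axis_def)
  then show ?thesis by (metis tangent_of_add[OF assms] tangent_of_scaleR[OF assms])
qed

lemma tangent_space_scaleR:
  assumes v: "v \<in> tangent_space A p"
  shows "r *\<^sub>R v \<in> tangent_space A p"
proof (rule tangent_spaceI)
  fix c d assume c: "c \<in> charts_at A p" and d: "d \<in> charts_at A p"
  show "(r *\<^sub>R v) d = frechet_derivative (cmap d \<circ> cinv c) (at (cmap c p)) ((r *\<^sub>R v) c)"
    using tangent_component[OF v c d]
      linear_cmul[OF bounded_linear.linear[OF bounded_linear_transition[OF c d]], of r "v c"]
    by (simp add: scaleR_fun_def)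
qed (use tangent_space_outside[OF v] in \<open>simp add: scaleR_fun_def\<close>)

text \<open>The component in \<open>d\<close> of a coordinate field of \<open>c\<close> is a column of the Jacobian of the change from
  \<open>c\<close> to \<open>d\<close>; in the coordinates of a third chart \<open>e\<close> it is composed with the change from \<open>e\<close> to \<open>c\<close>.\<close>

lemma smooth_coord_component:
  assumes c: "c \<in> A" and d: "d \<in> A" and e: "e \<in> A"
  shows "smooth_on (cmap e ` (cdom c \<inter> cdom d \<inter> cdom e)) (\<lambda>x. coord_field A c j (cinv e x) d)"
proof -
  let ?S = "cmap e ` (cdom c \<inter> cdom d \<inter> cdom e)"
  have S: "open ?S" using openin_Int[OF cdom_open[OF c] cdom_open[OF d]] by (rule open_chart_image[OF e])
  have sub: "?S \<subseteq> cmap e ` (cdom e \<inter> cdom c)" by auto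
  have img: "(cmap c \<circ> cinv e) ` ?S \<subseteq> cmap c ` (cdom c \<inter> cdom d)"
    using cinv_cmap[OF e] by auto
  have *: "smooth_on ?S (\<lambda>x. frechet_derivative (cmap d \<circ> cinv c) (at ((cmap c \<circ> cinv e) x)) (axis j 1))"
    by (rule smooth_on_compose[OF S open_overlap[OF c d] img
          smooth_on_directional[OF transition_smooth[OF c d]]
          smooth_on_subset[OF transition_smooth[OF e c] sub]])
  have "frechet_derivative (cmap d \<circ> cinv c) (at ((cmap c \<circ> cinv e) x)) (axis j 1)
      = coord_field A c j (cinv e x) d" if "x \<in> ?S" for x
    using that d cinv_cmap[OF e] by (auto simp: coord_field_def charts_at_def)
  then show ?thesis by (rule smooth_on_cong[OF S _ *])
qed

lemma smooth_coord_field: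
  assumes c: "c \<in> A"
  shows "smooth_vector_field X A (cdom c) (coord_field A c j)"
  unfolding smooth_vector_field_def
proof (intro conjI ballI)
  show "openin X (cdom c)" by (rule cdom_open[OF c])
  show "coord_field A c j p \<in> tangent_space A p" if "p \<in> cdom c" for p
    using that c by (simp add: coord_field_eq_tangent_of tangent_of_in_tangent_space charts_at_def)
  show "smooth_on (cmap d ` (cdom c \<inter> cdom d)) (\<lambda>x. coord_field A c j (cinv d x) d)" if "d \<in> A" for d
    using smooth_coord_component[OF c that that] by (simp add: Int_assoc)
qed

lemma smooth_vector_field_subset:
  assumes "smooth_vector_field X A U Y" "openin X V" "V \<subseteq> U"
  shows "smooth_vector_field X A V Y"
  unfolding smooth_vector_field_def
proof (intro conjI ballI)
  show "Y p \<in> tangent_space A p" if "p \<in> V" for p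
    using assms(1,3) that unfolding smooth_vector_field_def by blast
  show "smooth_on (cmap c ` (V \<inter> cdom c)) (\<lambda>x. Y (cinv c x) c)" if "c \<in> A" for c
  proof (rule smooth_on_subset)
    show "smooth_on (cmap c ` (U \<inter> cdom c)) (\<lambda>x. Y (cinv c x) c)"
      using assms(1) that unfolding smooth_vector_field_def by blast
  qed (use assms(3) in blast)
qed (rule assms(2))

lemma smooth_vector_field_scale:
  assumes Y: "smooth_vector_field X A U Y" and f: "smooth_function A U f"
  shows "smooth_vector_field X A U (\<lambda>q. f q *\<^sub>R Y q)"
  unfolding smooth_vector_field_def
proof (intro conjI ballI)
  show U: "openin X U" using Y by (simp add: smooth_vector_field_def)
  show "f p *\<^sub>R Y p \<in> tangent_space A p" if "p \<in> U" for p
    using Y that by (simp add: smooth_vector_field_def tangent_space_scaleR)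
  show "smooth_on (cmap c ` (U \<inter> cdom c)) (\<lambda>x. (f (cinv c x) *\<^sub>R Y (cinv c x)) c)" if c: "c \<in> A" for c
    using smooth_on_scaleR[OF open_chart_image[OF c U], of "\<lambda>x. f (cinv c x)" "\<lambda>x. Y (cinv c x) c"]
      Y f c by (simp add: smooth_vector_field_def smooth_function_def scaleR_fun_def comp_def)
qed

lemma dir_deriv_chart:
  assumes U: "openin X U" "p \<in> U" and f: "smooth_function A U f"
    and v: "v \<in> tangent_space A p" and c: "c \<in> charts_at A p"
  shows "dir_deriv A p v f = frechet_derivative (f \<circ> cinv c) (at (cmap c p)) (v c)"
proof -
  define d where "d = (SOME c. c \<in> charts_at A p)"
  have d: "d \<in> charts_at A p" unfolding d_def using c by (rule someI)
  have A: "c \<in> A" "d \<in> A" and p: "p \<in> cdom c" "p \<in> cdom d" using c d by (auto simp: charts_at_def)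
  have "((f \<circ> cinv c) has_derivative frechet_derivative (f \<circ> cinv c) (at (cmap c p)))
      (at ((cmap c \<circ> cinv d) (cmap d p)))"
    using f A p U cinv_cmap[OF A(2) p(2)]
    by (simp, intro smooth_on_has_derivative[of "cmap c ` (U \<inter> cdom c)"]) (auto simp: smooth_function_def)
  from has_derivative_compose[OF transition_has_derivative[OF d c] this]
  have "((\<lambda>x. (f \<circ> cinv c) ((cmap c \<circ> cinv d) x)) has_derivative
      (\<lambda>w. frechet_derivative (f \<circ> cinv c) (at (cmap c p))
        (frechet_derivative (cmap c \<circ> cinv d) (at (cmap d p)) w))) (at (cmap d p))" .
  note frechet_derivative_at[OF this]
  moreover have "frechet_derivative (\<lambda>x. (f \<circ> cinv c) ((cmap c \<circ> cinv d) x)) (at (cmap d p))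
      = frechet_derivative (f \<circ> cinv d) (at (cmap d p))"
    using A p cinv_cmap open_overlap[of d c]
    by (intro frechet_derivative_cong_open[of "cmap d ` (cdom d \<inter> cdom c)"]) auto
  ultimately have "frechet_derivative (f \<circ> cinv d) (at (cmap d p)) (v d)
      = frechet_derivative (f \<circ> cinv c) (at (cmap c p)) (frechet_derivative (cmap c \<circ> cinv d) (at (cmap d p)) (v d))"
    by (metis (no_types))
  then show ?thesis
    using tangent_component[OF v d c] by (simp add: dir_deriv_def d_def[symmetric])
qed

end

section \<open>Connections and covariant derivatives in charts\<close>

locale surface_with_connection = smooth_atlas X A for X :: "'p topology" and A +
  fixes nabla :: "'p connection"
  assumes connection: "affine_connection X A nabla"
begin

lemma nabla_smooth:
  "smooth_vector_field X A U Y \<Longrightarrow> smooth_vector_field X A U Z \<Longrightarrow>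
    smooth_vector_field X A U (\<lambda>p. nabla p (Y p) Z)"
  using connection unfolding affine_connection_def by blast

lemma
  assumes "smooth_vector_field X A U Y" "p \<in> U" "v \<in> tangent_space A p"
  shows nabla_tangent: "nabla p v Y \<in> tangent_space A p"
    and nabla_linear: "w \<in> tangent_space A p \<Longrightarrow>
      nabla p (a *\<^sub>R v + b *\<^sub>R w) Y = a *\<^sub>R nabla p v Y + b *\<^sub>R nabla p w Y"
    and nabla_add: "smooth_vector_field X A U Z \<Longrightarrow>
      nabla p v (\<lambda>q. Y q + Z q) = nabla p v Y + nabla p v Z"
    and nabla_leibniz: "smooth_function A U f \<Longrightarrow>
      nabla p v (\<lambda>q. f q *\<^sub>R Y q) = dir_deriv A p v f *\<^sub>R Y p + f p *\<^sub>R nabla p v Y"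
    and nabla_local: "(\<And>q. q \<in> U \<Longrightarrow> Z q = Y q) \<Longrightarrow> nabla p v Z = nabla p v Y"
proof -
  note * = connection[unfolded affine_connection_def, THEN conjunct2, THEN spec, THEN spec,
      THEN mp, OF assms(1), THEN bspec, OF assms(2), THEN bspec, OF assms(3)]
  note ** = *[THEN conjunct2] note *** = **[THEN conjunct2] note **** = ***[THEN conjunct2]
  show "nabla p v Y \<in> tangent_space A p" by (rule *[THEN conjunct1])
  show "nabla p (a *\<^sub>R v + b *\<^sub>R w) Y = a *\<^sub>R nabla p v Y + b *\<^sub>R nabla p w Y"
    if "w \<in> tangent_space A p" by (rule **[THEN conjunct1, rule_format, OF that])
  show "nabla p v (\<lambda>q. Y q + Z q) = nabla p v Y + nabla p v Z"
    if "smooth_vector_field X A U Z" by (rule ***[THEN conjunct1, rule_format, OF that])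
  show "nabla p v (\<lambda>q. f q *\<^sub>R Y q) = dir_deriv A p v f *\<^sub>R Y p + f p *\<^sub>R nabla p v Y"
    if "smooth_function A U f" by (rule ****[THEN conjunct1, rule_format, OF that])
  show "nabla p v Z = nabla p v Y" if "\<And>q. q \<in> U \<Longrightarrow> Z q = Y q"
    using that ****[THEN conjunct2] by blast
qed

text \<open>The vector of the \<open>\<Gamma>\<^sup>k\<^sub>i\<^sub>j\<close>, \<open>k = 1, 2\<close>, as a function of the coordinates, and the bilinear
  expression \<open>\<Gamma>(\<xi>, w)\<close> by which covariant differentiation in the direction \<open>\<xi>\<close> differs from
  differentiation of the component \<open>w\<close>.\<close>

definition christoffel :: "'p chart \<Rightarrow> 2 \<Rightarrow> 2 \<Rightarrow> real ^ 2 \<Rightarrow> real ^ 2" where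
  "christoffel c i j x = nabla (cinv c x) (coord_field A c i (cinv c x)) (coord_field A c j) c"

definition christoffel_term :: "'p chart \<Rightarrow> real ^ 2 \<Rightarrow> real ^ 2 \<Rightarrow> real ^ 2 \<Rightarrow> real ^ 2" where
  "christoffel_term c x \<xi> w = (\<Sum>j\<in>UNIV. \<Sum>i\<in>UNIV. (w $ j * \<xi> $ i) *\<^sub>R christoffel c i j x)"

lemma smooth_christoffel:
  assumes c: "c \<in> A" shows "smooth_on (cmap c ` cdom c) (christoffel c i j)"
proof -
  have "smooth_vector_field X A (cdom c) (\<lambda>p. nabla p (coord_field A c i p) (coord_field A c j))"
    by (rule nabla_smooth[OF smooth_coord_field[OF c] smooth_coord_field[OF c]])
  then have "smooth_on (cmap c ` (cdom c \<inter> cdom c))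
      (\<lambda>x. nabla (cinv c x) (coord_field A c i (cinv c x)) (coord_field A c j) c)"
    using c unfolding smooth_vector_field_def by blast
  then show ?thesis by (simp add: christoffel_def[abs_def])
qed

lemma nabla_coord_field_component:
  assumes c: "c \<in> charts_at A p" and v: "v \<in> tangent_space A p"
  shows "nabla p v (coord_field A c j) c = (\<Sum>i\<in>UNIV. (v c $ i) *\<^sub>R christoffel c i j (cmap c p))"
proof -
  have cA: "c \<in> A" and p: "p \<in> cdom c" using c by (auto simp: charts_at_def)
  have E: "coord_field A c i p \<in> tangent_space A p" for i
    by (simp add: coord_field_eq_tangent_of tangent_of_in_tangent_space[OF c])
  have "v = (v c $ 1) *\<^sub>R coord_field A c 1 p + (v c $ 2) *\<^sub>R coord_field A c 2 p"
    unfolding coord_field_eq_tangent_of tangent_of_expand[OF c, symmetric]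
    by (rule tangent_eq_tangent_of[OF v c])
  then have "nabla p v (coord_field A c j) = (v c $ 1) *\<^sub>R nabla p (coord_field A c 1 p) (coord_field A c j)
      + (v c $ 2) *\<^sub>R nabla p (coord_field A c 2 p) (coord_field A c j)"
    using nabla_linear[OF smooth_coord_field[OF cA] p E E] by metis
  then show ?thesis
    by (simp add: sum_2 christoffel_def cinv_cmap[OF cA p] scaleR_fun_def)
qed

text \<open>The transformation law of the Christoffel symbols. On the overlap of the charts, the coordinate
  field of \<open>c\<close> is a combination of those of \<open>d\<close>, and its coefficients are the functions \<open>\<phi> j\<close>, the
  columns of the Jacobian. The Leibniz rule differentiates the coefficients, which produces the
  second derivatives of the coordinate change in the first summand.\<close>

lemma nabla_coord_field_change:
  assumes c: "c \<in> charts_at A p" and d: "d \<in> charts_at A p" and v: "v \<in> tangent_space A p"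
  defines "\<phi> \<equiv> \<lambda>j x. frechet_derivative (cmap d \<circ> cinv c) (at x) (axis j 1)"
  shows "nabla p v (coord_field A c j) d = frechet_derivative (\<phi> j) (at (cmap c p)) (v c)
    + (\<Sum>i\<in>UNIV. (\<phi> j (cmap c p) $ i) *\<^sub>R nabla p v (coord_field A d i) d)"
proof -
  define U where "U = cdom c \<inter> cdom d"
  have cA: "c \<in> A" and dA: "d \<in> A" and p: "p \<in> U" using c d by (auto simp: charts_at_def U_def)
  have U: "openin X U" unfolding U_def by (intro openin_Int cdom_open cA dA)
  define f where "f = (\<lambda>i q. coord_field A c j q d $ i)"
  have f: "smooth_function A U (f i)" for i
    unfolding smooth_function_def
  proof
    fix e assume e: "e \<in> A"
    have "smooth_on (cmap e ` (cdom c \<inter> cdom d \<inter> cdom e)) (\<lambda>x. coord_field A c j (cinv e x) d $ i)"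
      using open_chart_image[OF e U] unfolding U_def
      by (intro smooth_on_bounded_linear[OF _ bounded_linear_vec_nth] smooth_coord_component cA dA e)
    then show "smooth_on (cmap e ` (U \<inter> cdom e)) (f i \<circ> cinv e)"
      by (simp add: f_def U_def comp_def)
  qed
  have Ec: "smooth_vector_field X A U (coord_field A c j)"
    by (rule smooth_vector_field_subset[OF smooth_coord_field[OF cA] U]) (simp add: U_def)
  have Ed: "smooth_vector_field X A U (coord_field A d i)" for i
    by (rule smooth_vector_field_subset[OF smooth_coord_field[OF dA] U]) (simp add: U_def)
  have fEd: "smooth_vector_field X A U (\<lambda>q. f i q *\<^sub>R coord_field A d i q)" for i
    by (rule smooth_vector_field_scale[OF Ed f])
  have eq: "f 1 q *\<^sub>R coord_field A d 1 q + f 2 q *\<^sub>R coord_field A d 2 q = coord_field A c j q"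
    if q: "q \<in> U" for q
  proof -
    have cq: "c \<in> charts_at A q" and dq: "d \<in> charts_at A q"
      using q cA dA by (auto simp: charts_at_def U_def)
    have "coord_field A c j q \<in> tangent_space A q"
      by (simp add: coord_field_eq_tangent_of tangent_of_in_tangent_space[OF cq])
    then show ?thesis unfolding f_def coord_field_eq_tangent_of[of A d] tangent_of_expand[OF dq, symmetric]
      by (rule tangent_eq_tangent_of[OF _ dq, symmetric])
  qed
  have "nabla p v (\<lambda>q. f 1 q *\<^sub>R coord_field A d 1 q + f 2 q *\<^sub>R coord_field A d 2 q)
      = nabla p v (coord_field A c j)"
    by (rule nabla_local[OF Ec p v]) (rule eq)
  then have "nabla p v (coord_field A c j)
      = (dir_deriv A p v (f 1) *\<^sub>R coord_field A d 1 p + f 1 p *\<^sub>R nabla p v (coord_field A d 1))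
      + (dir_deriv A p v (f 2) *\<^sub>R coord_field A d 2 p + f 2 p *\<^sub>R nabla p v (coord_field A d 2))"
    by (simp only: nabla_add[OF fEd p v fEd] nabla_leibniz[OF Ed p v f])
  then have "nabla p v (coord_field A c j) d
      = (dir_deriv A p v (f 1) *\<^sub>R axis 1 1 + f 1 p *\<^sub>R nabla p v (coord_field A d 1) d)
      + (dir_deriv A p v (f 2) *\<^sub>R axis 2 1 + f 2 p *\<^sub>R nabla p v (coord_field A d 2) d)"
    by (simp add: scaleR_fun_def coord_field_eq_tangent_of tangent_of_component[OF d])
  moreover have "f i p = \<phi> j (cmap c p) $ i" for i
    using d by (simp add: f_def \<phi>_def coord_field_def)
  moreover have "dir_deriv A p v (f i) = frechet_derivative (\<phi> j) (at (cmap c p)) (v c) $ i" for i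
  proof -
    have x: "cmap c p \<in> cmap c ` U" and oU: "open (cmap c ` U)"
      using p open_overlap[OF cA dA] by (auto simp: U_def)
    have "(\<phi> j has_derivative frechet_derivative (\<phi> j) (at (cmap c p))) (at (cmap c p))"
      unfolding \<phi>_def using x
      by (intro smooth_on_has_derivative[OF smooth_on_directional[OF transition_smooth[OF cA dA]]])
        (simp add: U_def)
    then have "((\<lambda>x. \<phi> j x $ i) has_derivative (\<lambda>w. frechet_derivative (\<phi> j) (at (cmap c p)) w $ i))
        (at (cmap c p))"
      by (rule bounded_linear.has_derivative[OF bounded_linear_vec_nth])
    from frechet_derivative_at[OF this] have "frechet_derivative (\<phi> j) (at (cmap c p)) (v c) $ i
        = frechet_derivative (\<lambda>x. \<phi> j x $ i) (at (cmap c p)) (v c)"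
      by (simp add: fun_eq_iff)
    also have "frechet_derivative (\<lambda>x. \<phi> j x $ i) (at (cmap c p))
        = frechet_derivative (f i \<circ> cinv c) (at (cmap c p))"
      using cinv_cmap[OF cA] cA dA
      by (intro frechet_derivative_cong_open[OF oU x])
        (auto simp: U_def f_def \<phi>_def coord_field_def charts_at_def)
    finally show ?thesis using dir_deriv_chart[OF U p f v c] by simp
  qed
  ultimately show ?thesis
    by (simp add: sum_2 vec_eq_iff forall_2 axis_def)
qed

text \<open>Here \<open>\<gamma>\<close> is continuous only through its expression in the chart \<open>c\<close>, so that membership in
  \<open>cdom d\<close> has to be read off from the coordinates in \<open>c\<close>.\<close>

lemma eventually_in_overlap:
  assumes c: "c \<in> charts_at A (\<gamma> s)" and d: "d \<in> charts_at A (\<gamma> s)"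
    and cont: "continuous (at s within I) (\<lambda>r. cmap c (\<gamma> r))"
    and ev: "\<forall>\<^sub>F r in at s within I. \<gamma> r \<in> cdom c"
  shows "\<forall>\<^sub>F r in at s within I. \<gamma> r \<in> cdom c \<inter> cdom d"
proof -
  have A: "c \<in> A" "d \<in> A" and p: "\<gamma> s \<in> cdom c" "\<gamma> s \<in> cdom d" using c d by (auto simp: charts_at_def)
  have "((\<lambda>r. cmap c (\<gamma> r)) \<longlongrightarrow> cmap c (\<gamma> s)) (at s within I)"
    using cont by (simp add: continuous_within)
  then have "\<forall>\<^sub>F r in at s within I. cmap c (\<gamma> r) \<in> cmap c ` (cdom c \<inter> cdom d)"
    using open_overlap[OF A] p by (intro topological_tendstoD) auto
  with ev show ?thesis
  proof eventually_elim
    case (elim r)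
    then obtain q where "q \<in> cdom c \<inter> cdom d" "cmap c (\<gamma> r) = cmap c q" by auto
    then show ?case using chart_inj[OF A(1)] elim by (metis IntD1 inj_on_def)
  qed
qed

lemma has_vector_derivative_chart_change:
  assumes c: "c \<in> charts_at A (\<gamma> s)" and d: "d \<in> charts_at A (\<gamma> s)" and s: "s \<in> I"
    and deriv: "((\<lambda>r. cmap c (\<gamma> r)) has_vector_derivative \<xi>) (at s within I)"
    and ev: "\<forall>\<^sub>F r in at s within I. \<gamma> r \<in> cdom c"
  shows "((\<lambda>r. cmap d (\<gamma> r)) has_vector_derivative
    frechet_derivative (cmap d \<circ> cinv c) (at (cmap c (\<gamma> s))) \<xi>) (at s within I)"
proof -
  have A: "c \<in> A" "d \<in> A" and p: "\<gamma> s \<in> cdom c" using c d by (auto simp: charts_at_def)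
  have "((\<lambda>r. (cmap d \<circ> cinv c) (cmap c (\<gamma> r))) has_derivative
      (\<lambda>h. frechet_derivative (cmap d \<circ> cinv c) (at (cmap c (\<gamma> s))) (h *\<^sub>R \<xi>))) (at s within I)"
    by (rule has_derivative_compose[OF deriv[unfolded has_vector_derivative_def] transition_has_derivative[OF c d]])
  then have "((\<lambda>r. (cmap d \<circ> cinv c) (cmap c (\<gamma> r))) has_derivative
      (\<lambda>h. h *\<^sub>R frechet_derivative (cmap d \<circ> cinv c) (at (cmap c (\<gamma> s))) \<xi>)) (at s within I)"
    by (simp only: linear_cmul[OF bounded_linear.linear[OF bounded_linear_transition[OF c d]]])
  then show ?thesis unfolding has_vector_derivative_def
  proof (rule has_derivative_transform_eventually)
    show "\<forall>\<^sub>F r in at s within I. (cmap d \<circ> cinv c) (cmap c (\<gamma> r)) = cmap d (\<gamma> r)"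
      using ev by eventually_elim (simp add: cinv_cmap[OF A(1)])
  qed (use p s cinv_cmap[OF A(1)] in auto)
qed

lemma velocity_eq_tangent_of:
  assumes c: "c \<in> charts_at A (\<gamma> s)" and s: "s \<in> I" and nontriv: "at s within I \<noteq> bot"
    and deriv: "((\<lambda>r. cmap c (\<gamma> r)) has_vector_derivative \<xi>) (at s within I)"
    and ev: "\<forall>\<^sub>F r in at s within I. \<gamma> r \<in> cdom c"
  shows "velocity A I \<gamma> s = tangent_of A c (\<gamma> s) \<xi>"
  using vector_derivative_within[OF nontriv has_vector_derivative_chart_change[OF c _ s deriv ev]]
  by (auto simp: velocity_def tangent_of_def)

lemma cov_deriv_along_component:
  assumes c: "c \<in> charts_at A (\<gamma> s)" and s: "s \<in> I" and nontriv: "at s within I \<noteq> bot"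
    and deriv: "((\<lambda>r. cmap c (\<gamma> r)) has_vector_derivative \<xi>) (at s within I)"
    and ev: "\<forall>\<^sub>F r in at s within I. \<gamma> r \<in> cdom c"
  shows "cov_deriv_along A nabla I \<gamma> V s c
    = vector_derivative (\<lambda>r. V r c) (at s within I) + christoffel_term c (cmap c (\<gamma> s)) \<xi> (V s c)"
  using c nabla_coord_field_component[OF c tangent_of_in_tangent_space[OF c, of \<xi>]]
  by (simp add: cov_deriv_along_def velocity_eq_tangent_of[OF assms] christoffel_term_def
      tangent_of_component[OF c] scaleR_sum_right)

text \<open>The components in \<open>d\<close> are the Jacobian applied to those in \<open>c\<close>, and the Jacobian varies along the
  curve. The product rule therefore gives a second summand, which keeps the derivatives of components
  from being a tangent vector.\<close>

lemma field_derivative_chart_change: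
  assumes c: "c \<in> charts_at A (\<gamma> s)" and d: "d \<in> charts_at A (\<gamma> s)" and s: "s \<in> I"
    and deriv: "((\<lambda>r. cmap c (\<gamma> r)) has_vector_derivative \<xi>) (at s within I)"
    and ev: "\<forall>\<^sub>F r in at s within I. \<gamma> r \<in> cdom c"
    and V: "\<And>r. r \<in> I \<Longrightarrow> V r \<in> tangent_space A (\<gamma> r)"
    and V': "((\<lambda>r. V r c) has_vector_derivative \<eta>) (at s within I)"
  defines "\<phi> \<equiv> \<lambda>j x. frechet_derivative (cmap d \<circ> cinv c) (at x) (axis j 1)"
  shows "((\<lambda>r. V r d) has_vector_derivative
      frechet_derivative (cmap d \<circ> cinv c) (at (cmap c (\<gamma> s))) \<eta>
      + (\<Sum>j\<in>UNIV. (V s c $ j) *\<^sub>R frechet_derivative (\<phi> j) (at (cmap c (\<gamma> s))) \<xi>)) (at s within I)"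
proof -
  let ?J = "\<lambda>x. frechet_derivative (cmap d \<circ> cinv c) (at x)"
  have A: "c \<in> A" "d \<in> A" and p: "\<gamma> s \<in> cdom c" "\<gamma> s \<in> cdom d" using c d by (auto simp: charts_at_def)
  have expand: "?J (cmap c q) w = (w $ 1) *\<^sub>R \<phi> 1 (cmap c q) + (w $ 2) *\<^sub>R \<phi> 2 (cmap c q)"
    if "q \<in> cdom c \<inter> cdom d" for w q
  proof -
    have "c \<in> charts_at A q" "d \<in> charts_at A q" using that A by (auto simp: charts_at_def)
    then show ?thesis using fun_cong[OF tangent_of_expand[of c q w], of d]
      by (simp add: tangent_of_def scaleR_fun_def \<phi>_def)
  qed
  have \<phi>': "((\<lambda>r. \<phi> j (cmap c (\<gamma> r))) has_vector_derivative frechet_derivative (\<phi> j) (at (cmap c (\<gamma> s))) \<xi>)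
      (at s within I)" for j
  proof -
    have *: "(\<phi> j has_derivative frechet_derivative (\<phi> j) (at (cmap c (\<gamma> s)))) (at (cmap c (\<gamma> s)))"
      unfolding \<phi>_def using p
      by (intro smooth_on_has_derivative[OF smooth_on_directional[OF transition_smooth[OF A]]]) simp
    have "((\<lambda>r. \<phi> j (cmap c (\<gamma> r))) has_derivative
        (\<lambda>h. frechet_derivative (\<phi> j) (at (cmap c (\<gamma> s))) (h *\<^sub>R \<xi>))) (at s within I)"
      by (rule has_derivative_compose[OF deriv[unfolded has_vector_derivative_def] *])
    then show ?thesis unfolding has_vector_derivative_def
      by (simp only: linear_cmul[OF bounded_linear.linear[OF has_derivative_bounded_linear[OF *]]])
  qed
  have comp: "((\<lambda>r. V r c $ j) has_real_derivative \<eta> $ j) (at s within I)" for j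
    unfolding has_real_derivative_iff_has_vector_derivative
    by (rule bounded_linear.has_vector_derivative[OF bounded_linear_vec_nth V'])
  have "((\<lambda>r. (V r c $ 1) *\<^sub>R \<phi> 1 (cmap c (\<gamma> r)) + (V r c $ 2) *\<^sub>R \<phi> 2 (cmap c (\<gamma> r)))
      has_vector_derivative
      ((V s c $ 1) *\<^sub>R frechet_derivative (\<phi> 1) (at (cmap c (\<gamma> s))) \<xi> + (\<eta> $ 1) *\<^sub>R \<phi> 1 (cmap c (\<gamma> s)))
      + ((V s c $ 2) *\<^sub>R frechet_derivative (\<phi> 2) (at (cmap c (\<gamma> s))) \<xi> + (\<eta> $ 2) *\<^sub>R \<phi> 2 (cmap c (\<gamma> s))))
      (at s within I)"
    by (intro has_vector_derivative_add has_vector_derivative_scaleR comp \<phi>')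
  then have *: "((\<lambda>r. (V r c $ 1) *\<^sub>R \<phi> 1 (cmap c (\<gamma> r)) + (V r c $ 2) *\<^sub>R \<phi> 2 (cmap c (\<gamma> r)))
      has_vector_derivative
      ?J (cmap c (\<gamma> s)) \<eta> + (\<Sum>j\<in>UNIV. (V s c $ j) *\<^sub>R frechet_derivative (\<phi> j) (at (cmap c (\<gamma> s))) \<xi>))
      (at s within I)"
    using p by (simp add: expand sum_2 algebra_simps)
  have eq: "(V r c $ 1) *\<^sub>R \<phi> 1 (cmap c (\<gamma> r)) + (V r c $ 2) *\<^sub>R \<phi> 2 (cmap c (\<gamma> r)) = V r d"
    if "r \<in> I" "\<gamma> r \<in> cdom c \<inter> cdom d" for r
    using that A tangent_component[OF V[OF that(1)], of c d] expand[OF that(2), of "V r c"]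
    by (simp add: charts_at_def)
  have "\<forall>\<^sub>F r in at s within I. \<gamma> r \<in> cdom c \<inter> cdom d"
    by (rule eventually_in_overlap[OF c d has_vector_derivative_continuous[OF deriv] ev])
  moreover have "\<forall>\<^sub>F r in at s within I. r \<in> I" by (simp add: eventually_at_filter)
  ultimately have "\<forall>\<^sub>F r in at s within I.
      (V r c $ 1) *\<^sub>R \<phi> 1 (cmap c (\<gamma> r)) + (V r c $ 2) *\<^sub>R \<phi> 2 (cmap c (\<gamma> r)) = V r d"
    by eventually_elim (rule eq)
  from has_derivative_transform_eventually[OF *[unfolded has_vector_derivative_def] this eq[OF s] s] p
  show ?thesis unfolding has_vector_derivative_def by simp
qed

text \<open>The covariant derivative along a curve is a tangent vector: the non-tensorial summand in
  \<open>field_derivative_chart_change\<close> cancels the one in \<open>nabla_coord_field_change\<close>.\<close>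

lemma cov_deriv_along_chart_change:
  assumes c: "c \<in> charts_at A (\<gamma> s)" and d: "d \<in> charts_at A (\<gamma> s)" and s: "s \<in> I"
    and nontriv: "at s within I \<noteq> bot"
    and deriv: "((\<lambda>r. cmap c (\<gamma> r)) has_vector_derivative \<xi>) (at s within I)"
    and ev: "\<forall>\<^sub>F r in at s within I. \<gamma> r \<in> cdom c"
    and V: "\<And>r. r \<in> I \<Longrightarrow> V r \<in> tangent_space A (\<gamma> r)"
    and V': "((\<lambda>r. V r c) has_vector_derivative \<eta>) (at s within I)"
  shows "cov_deriv_along A nabla I \<gamma> V s d
    = frechet_derivative (cmap d \<circ> cinv c) (at (cmap c (\<gamma> s))) (cov_deriv_along A nabla I \<gamma> V s c)"
proof -
  let ?p = "\<gamma> s" and ?x = "cmap c (\<gamma> s)" and ?v = "velocity A I \<gamma> s"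
  let ?J = "frechet_derivative (cmap d \<circ> cinv c) (at ?x)"
  define \<phi> where "\<phi> = (\<lambda>j x. frechet_derivative (cmap d \<circ> cinv c) (at x) (axis j 1))"
  have A: "c \<in> A" and p: "?p \<in> cdom c" using c by (auto simp: charts_at_def)
  have v: "?v \<in> tangent_space A ?p" and vc: "?v c = \<xi>"
    unfolding velocity_eq_tangent_of[OF c s nontriv deriv ev]
    by (simp_all add: tangent_of_in_tangent_space[OF c] tangent_of_component[OF c])
  interpret J: linear ?J
    by (rule bounded_linear.linear[OF bounded_linear_transition[OF c d]])
  have change: "nabla ?p ?v (coord_field A c j) d = frechet_derivative (\<phi> j) (at ?x) \<xi>
      + (\<Sum>i\<in>UNIV. (\<phi> j ?x $ i) *\<^sub>R nabla ?p ?v (coord_field A d i) d)" for j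
    using nabla_coord_field_change[OF c d v, of j] vc by (simp add: \<phi>_def)
  have J: "?J (nabla ?p ?v (coord_field A c j) c) = nabla ?p ?v (coord_field A c j) d" for j
    by (rule tangent_component[OF nabla_tangent[OF smooth_coord_field[OF A] p v] c d, symmetric])
  have Vd: "V s d = (V s c $ 1) *\<^sub>R \<phi> 1 ?x + (V s c $ 2) *\<^sub>R \<phi> 2 ?x"
    using fun_cong[OF tangent_of_expand[OF c, of "V s c"], of d] d
      tangent_component[OF V[OF s] c d] by (simp add: tangent_of_def scaleR_fun_def \<phi>_def)
  have "cov_deriv_along A nabla I \<gamma> V s d
      = ?J \<eta> + (\<Sum>j\<in>UNIV. (V s c $ j) *\<^sub>R frechet_derivative (\<phi> j) (at ?x) \<xi>)
        + (\<Sum>i\<in>UNIV. (V s d $ i) *\<^sub>R nabla ?p ?v (coord_field A d i) d)"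
    using vector_derivative_within[OF nontriv field_derivative_chart_change[OF c d s deriv ev V V']] d
    by (simp add: cov_deriv_along_def \<phi>_def)
  also have "\<dots> = ?J \<eta> + (\<Sum>j\<in>UNIV. (V s c $ j) *\<^sub>R nabla ?p ?v (coord_field A c j) d)"
    unfolding change Vd by (simp add: sum_2 algebra_simps)
  also have "\<dots> = ?J (\<eta> + (\<Sum>j\<in>UNIV. (V s c $ j) *\<^sub>R nabla ?p ?v (coord_field A c j) c))"
    by (simp add: J.add J.sum J.scaleR J)
  also have "\<eta> + (\<Sum>j\<in>UNIV. (V s c $ j) *\<^sub>R nabla ?p ?v (coord_field A c j) c)
      = cov_deriv_along A nabla I \<gamma> V s c"
    using c vector_derivative_within[OF nontriv V'] by (simp add: cov_deriv_along_def)
  finally show ?thesis .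
qed

end

section \<open>Parallel transport in a chart\<close>

text \<open>A continuously differentiable curve on a compact interval, contained in the domain of one chart;
  \<open>x'\<close> is the derivative of its coordinates.\<close>

locale curve_in_chart = surface_with_connection X A nabla for X :: "'p topology" and A nabla +
  fixes c :: "'p chart" and \<gamma> :: "real \<Rightarrow> 'p" and x' :: "real \<Rightarrow> real ^ 2" and a b :: real
  assumes chart: "c \<in> A" and ab: "a < b" and in_chart: "\<And>s. s \<in> {a..b} \<Longrightarrow> \<gamma> s \<in> cdom c"
    and deriv: "\<And>s. s \<in> {a..b} \<Longrightarrow>
      ((\<lambda>s. cmap c (\<gamma> s)) has_vector_derivative x' s) (at s within {a..b})"
    and cont: "continuous_on {a..b} x'"
begin

text \<open>The right-hand side of the equation of parallel transport, solved for the derivative of the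
  component in the chart.\<close>

definition transport_rhs :: "real \<Rightarrow> real ^ 2 \<Rightarrow> real ^ 2" where
  "transport_rhs s w = - christoffel_term c (cmap c (\<gamma> s)) (x' s) w"

lemma chart_at: "s \<in> {a..b} \<Longrightarrow> c \<in> charts_at A (\<gamma> s)"
  using chart in_chart by (simp add: charts_at_def)

lemma eventually_in_chart: "\<forall>\<^sub>F r in at s within {a..b}. \<gamma> r \<in> cdom c"
  using in_chart by (simp add: eventually_at_filter)

lemma continuous_on_christoffel: "continuous_on {a..b} (\<lambda>s. christoffel c i j (cmap c (\<gamma> s)))"
  by (rule continuous_on_compose2[OF smooth_on_continuous_on[OF smooth_christoffel[OF chart]]
        continuous_on_vector_derivative[OF deriv]]) (use in_chart in auto)

lemma continuous_on_transport_rhs: "continuous_on ({a..b} \<times> UNIV) (\<lambda>(s, w). transport_rhs s w)"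
proof -
  have 1: "continuous_on ({a..b} \<times> UNIV) (\<lambda>z :: real \<times> (real ^ 2). christoffel c i j (cmap c (\<gamma> (fst z))))" for i j
    by (rule continuous_on_compose2[OF continuous_on_christoffel continuous_on_fst[OF continuous_on_id]]) auto
  have 2: "continuous_on ({a..b} \<times> UNIV) (\<lambda>z :: real \<times> (real ^ 2). x' (fst z))"
    by (rule continuous_on_compose2[OF cont continuous_on_fst[OF continuous_on_id]]) auto
  show ?thesis unfolding transport_rhs_def christoffel_term_def case_prod_beta
    by (intro continuous_intros 1 2)
qed

lemma transport_rhs_diff: "transport_rhs s v - transport_rhs s w = transport_rhs s (v - w)"
  by (simp add: transport_rhs_def christoffel_term_def sum_2 algebra_simps)

text \<open>The right-hand side is linear in \<open>w\<close> with coefficients that are continuous on a compact interval.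
  By linearity the bound is also a Lipschitz constant.\<close>

lemma transport_rhs_bound:
  obtains K where "0 \<le> K" "\<And>s w. s \<in> {a..b} \<Longrightarrow> norm (transport_rhs s w) \<le> K * norm w"
proof -
  have "\<exists>M. \<forall>s\<in>{a..b}. norm ((x' s $ i) *\<^sub>R christoffel c i j (cmap c (\<gamma> s))) \<le> M" for i j
  proof -
    have "continuous_on {a..b} (\<lambda>s. (x' s $ i) *\<^sub>R christoffel c i j (cmap c (\<gamma> s)))"
      by (intro continuous_intros cont continuous_on_christoffel)
    then have "bounded ((\<lambda>s. (x' s $ i) *\<^sub>R christoffel c i j (cmap c (\<gamma> s))) ` {a..b})"
      by (intro compact_imp_bounded compact_continuous_image) auto
    then show ?thesis unfolding bounded_iff by blast
  qed
  then have "\<forall>i j. \<exists>M. \<forall>s\<in>{a..b}. norm ((x' s $ i) *\<^sub>R christoffel c i j (cmap c (\<gamma> s))) \<le> M"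
    by blast
  then obtain M where M: "\<And>s i j. s \<in> {a..b} \<Longrightarrow>
      norm ((x' s $ i) *\<^sub>R christoffel c i j (cmap c (\<gamma> s))) \<le> M i j"
    unfolding choice_iff by blast
  have M0: "0 \<le> M i j" for i j using order_trans[OF norm_ge_zero M[of a i j]] ab by simp
  show ?thesis
  proof
    show "0 \<le> (\<Sum>j\<in>UNIV. \<Sum>i\<in>UNIV. M i j)" by (intro sum_nonneg M0)
    fix s w assume s: "s \<in> {a..b}"
    have "norm (transport_rhs s w)
        \<le> (\<Sum>j\<in>UNIV. \<Sum>i\<in>UNIV. norm ((w $ j * x' s $ i) *\<^sub>R christoffel c i j (cmap c (\<gamma> s))))"
      unfolding transport_rhs_def christoffel_term_def norm_minus_cancel
      by (intro sum_norm_le order_refl)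
    also have "\<dots> \<le> (\<Sum>j\<in>UNIV. \<Sum>i\<in>UNIV. norm w * M i j)"
    proof (intro sum_mono)
      fix i j
      have "norm ((w $ j * x' s $ i) *\<^sub>R christoffel c i j (cmap c (\<gamma> s)))
          = \<bar>w $ j\<bar> * norm ((x' s $ i) *\<^sub>R christoffel c i j (cmap c (\<gamma> s)))"
        by (simp add: abs_mult)
      also have "\<dots> \<le> norm w * M i j"
        by (intro mult_mono component_le_norm_cart M s) simp_all
      finally show "norm ((w $ j * x' s $ i) *\<^sub>R christoffel c i j (cmap c (\<gamma> s))) \<le> norm w * M i j" .
    qed
    finally show "norm (transport_rhs s w) \<le> (\<Sum>j\<in>UNIV. \<Sum>i\<in>UNIV. M i j) * norm w"
      by (simp add: sum_distrib_left sum_distrib_right mult.commute)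
  qed
qed

lemma cov_deriv_along_in_chart:
  assumes s: "s \<in> {a..b}"
  shows "cov_deriv_along A nabla {a..b} \<gamma> V s c
    = vector_derivative (\<lambda>r. V r c) (at s within {a..b}) - transport_rhs s (V s c)"
  using cov_deriv_along_component[OF chart_at[OF s] s at_within_Icc_nontrivial[OF ab s]
      deriv[OF s] eventually_in_chart] by (simp add: transport_rhs_def)

lemma parallel_along_imp_ode:
  assumes W: "parallel_along A nabla {a..b} \<gamma> W" and s: "s \<in> {a..b}"
  shows "((\<lambda>r. W r c) has_vector_derivative transport_rhs s (W s c)) (at s within {a..b})"
proof -
  have "(\<lambda>r. W r c) differentiable (at s within {a..b})" and "cov_deriv_along A nabla {a..b} \<gamma> W s = 0"
    using W s chart_at[OF s] unfolding parallel_along_def by blast+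
  then show ?thesis
    using cov_deriv_along_in_chart[OF s, of W] by (simp add: vector_derivative_works)
qed

text \<open>Being parallel is a condition in all charts at each point of the curve; it follows from the
  equation in one chart because the covariant derivative is a tangent vector.\<close>

lemma ode_imp_parallel_along:
  assumes w: "\<And>s. s \<in> {a..b} \<Longrightarrow> (w has_vector_derivative transport_rhs s (w s)) (at s within {a..b})"
  shows "parallel_along A nabla {a..b} \<gamma> (\<lambda>s. tangent_of A c (\<gamma> s) (w s))"
  unfolding parallel_along_def
proof (intro ballI conjI)
  let ?W = "\<lambda>s. tangent_of A c (\<gamma> s) (w s)"
  fix s assume s: "s \<in> {a..b}"
  show T: "?W s \<in> tangent_space A (\<gamma> s)" by (rule tangent_of_in_tangent_space[OF chart_at[OF s]])
  have Wc: "((\<lambda>r. ?W r c) has_vector_derivative transport_rhs s (w s)) (at s within {a..b})"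
    by (rule has_vector_derivative_transform[OF s _ w[OF s]]) (simp add: tangent_of_component chart_at)
  have TW: "?W r \<in> tangent_space A (\<gamma> r)" if "r \<in> {a..b}" for r
    by (rule tangent_of_in_tangent_space[OF chart_at[OF that]])
  note nontriv = at_within_Icc_nontrivial[OF ab s]
  show "(\<lambda>r. ?W r d) differentiable (at s within {a..b})" if d: "d \<in> charts_at A (\<gamma> s)" for d
    by (rule differentiableI_vector,
        rule field_derivative_chart_change[OF chart_at[OF s] d s deriv[OF s] eventually_in_chart TW Wc])
  have c0: "cov_deriv_along A nabla {a..b} \<gamma> ?W s c = 0"
    using vector_derivative_within[OF nontriv Wc]
    by (simp add: cov_deriv_along_in_chart[OF s] tangent_of_component[OF chart_at[OF s]])
  show "cov_deriv_along A nabla {a..b} \<gamma> ?W s = 0"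
  proof
    fix d show "cov_deriv_along A nabla {a..b} \<gamma> ?W s d = 0 d"
    proof (cases "d \<in> charts_at A (\<gamma> s)")
      case True
      then show ?thesis
        using cov_deriv_along_chart_change[OF chart_at[OF s] True s nontriv deriv[OF s] eventually_in_chart TW Wc]
          linear_0[OF bounded_linear.linear[OF bounded_linear_transition[OF chart_at[OF s] True]]]
        by (simp add: c0)
    qed (simp add: cov_deriv_along_def)
  qed
qed

text \<open>A definite description denotes its intended object only if this object exists and is unique: the
  given solution provides existence, and uniqueness is that of the equation in the chart.\<close>

lemma parallel_transport_back_eq:
  assumes bound: "\<And>s w. s \<in> {a..b} \<Longrightarrow> norm (transport_rhs s w) \<le> K * norm w"
    and K: "0 \<le> K" "K * (b - a) < 1"
    and w: "\<And>s. s \<in> {a..b} \<Longrightarrow> (w has_vector_derivative transport_rhs s (w s)) (at s within {a..b})"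
  shows "parallel_transport_back A nabla \<gamma> a b (tangent_of A c (\<gamma> b) (w b)) = tangent_of A c (\<gamma> a) (w a)"
  unfolding parallel_transport_back_def
proof (rule the_equality)
  show "\<exists>W. parallel_along A nabla {a..b} \<gamma> W \<and> W b = tangent_of A c (\<gamma> b) (w b)
      \<and> W a = tangent_of A c (\<gamma> a) (w a)"
    using ode_imp_parallel_along[OF w] by blast
  fix v assume "\<exists>W. parallel_along A nabla {a..b} \<gamma> W \<and> W b = tangent_of A c (\<gamma> b) (w b) \<and> W a = v"
  then obtain W where W: "parallel_along A nabla {a..b} \<gamma> W"
    and Wb: "W b = tangent_of A c (\<gamma> b) (w b)" and Wa: "W a = v" by blast
  have "W a c = w a"
  proof (rule short_ode_unique[where f = transport_rhs])
    show "norm (transport_rhs s x - transport_rhs s y) \<le> K * norm (x - y)" if "s \<in> {a..b}" for s x y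
      using bound[OF that] by (simp add: transport_rhs_diff)
    show "K * (b - a) < 1" "0 \<le> K" by (rule K)+
    show "((\<lambda>r. W r c) has_vector_derivative transport_rhs s (W s c)) (at s within {a..b})"
      if "s \<in> {a..b}" for s by (rule parallel_along_imp_ode[OF W that])
    show "(w has_vector_derivative transport_rhs s (w s)) (at s within {a..b})"
      if "s \<in> {a..b}" for s by (rule w[OF that])
    show "W b c = w b" using ab by (simp add: Wb tangent_of_component chart_at)
    show "a \<in> {a..b}" using ab by simp
  qed
  moreover have "W a \<in> tangent_space A (\<gamma> a)"
    using W ab unfolding parallel_along_def by simp
  then have "v = tangent_of A c (\<gamma> a) (W a c)"
    using ab tangent_eq_tangent_of[OF _ chart_at[of a], of v] by (simp add: Wa)
  ultimately show "v = tangent_of A c (\<gamma> a) (w a)" by simp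
qed

lemma initial_piece:
  assumes "0 < h" "a + h \<le> b"
  shows "curve_in_chart X A nabla c \<gamma> x' a (a + h)"
proof
  have sub: "{a..a+h} \<subseteq> {a..b}" using assms by auto
  show "((\<lambda>s. cmap c (\<gamma> s)) has_vector_derivative x' s) (at s within {a..a+h})" if "s \<in> {a..a+h}" for s
    using has_vector_derivative_within_subset[OF deriv sub] that sub by blast
  show "continuous_on {a..a+h} x'" by (rule continuous_on_subset[OF cont sub])
  show "\<gamma> s \<in> cdom c" if "s \<in> {a..a+h}" for s using in_chart sub that by blast
qed (use assms chart in auto)

text \<open>The covariant derivative at the initial point is the derivative of the field transported back to
  that point. The limit only involves short pieces of the curve, for which transport is known.\<close>

lemma covariant_derivative_by_transport:
  assumes V: "\<And>s. s \<in> {a..b} \<Longrightarrow> V s \<in> tangent_space A (\<gamma> s)"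
    and V': "\<And>s. s \<in> {a..b} \<Longrightarrow> ((\<lambda>r. V r c) has_vector_derivative V' s) (at s within {a..b})"
    and cont_V': "continuous_on {a..b} V'"
  shows "((\<lambda>h. (1 / h) *\<^sub>R (parallel_transport_back A nabla \<gamma> a (a + h) (V (a + h)) c - V a c))
    \<longlongrightarrow> V' a + christoffel_term c (cmap c (\<gamma> a)) (x' a) (V a c)) (at_right 0)"
proof -
  obtain K where K: "0 \<le> K" and bound: "\<And>s w. s \<in> {a..b} \<Longrightarrow> norm (transport_rhs s w) \<le> K * norm w"
    using transport_rhs_bound by blast
  \<comment> \<open>For small \<open>h\<close>, the component of the parallel field that agrees with \<open>V\<close> at \<open>a + h\<close>.\<close>
  define solves where "solves = (\<lambda>h w. w (a + h) = V (a + h) c \<and>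
    (\<forall>s\<in>{a..a+h}. (w has_vector_derivative transport_rhs s (w s)) (at s within {a..a+h})))"
  define W where "W = (\<lambda>h. SOME w. solves h w)"
  have "0 < min (b - a) (1 / (K + 1))" using ab K by simp
  then have small: "\<forall>\<^sub>F h in at_right 0. 0 < h \<and> h < min (b - a) (1 / (K + 1))"
    unfolding eventually_at_right_field by blast
  have Kh: "K * (a + h - a) < 1" if "0 < h" "h < 1 / (K + 1)" for h
  proof -
    have "K * h \<le> (K + 1) * h" using that by simp
    also have "\<dots> < 1" using that K by (simp add: field_simps)
    finally show ?thesis by simp
  qed
  have ev: "\<forall>\<^sub>F h in at_right 0. solves h (W h)"
    using small
  proof eventually_elim
    case (elim h)
    have sub: "{a..a+h} \<subseteq> {a..b}" using elim by auto
    have "\<exists>w. solves h w"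
    proof (rule short_ode_exists[of a "a + h" transport_rhs K "V (a + h) c"])
      show "continuous_on ({a..a+h} \<times> UNIV) (\<lambda>(s, w). transport_rhs s w)"
        by (rule continuous_on_subset[OF continuous_on_transport_rhs]) (use sub in auto)
      show "norm (transport_rhs s x - transport_rhs s y) \<le> K * norm (x - y)" if "s \<in> {a..a+h}" for s x y
        using bound that sub by (auto simp: transport_rhs_diff)
      show "K * (a + h - a) < 1" using Kh elim by simp
    qed (use elim K in \<open>auto simp: solves_def\<close>)
    then show ?case unfolding W_def by (rule someI_ex)
  qed
  have "((\<lambda>h. (1 / h) *\<^sub>R (W h a - V a c)) \<longlongrightarrow> V' a - transport_rhs a (V a c)) (at_right 0)"
    by (rule transport_difference_quotient[OF ab continuous_on_transport_rhs bound K V' cont_V'])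
      (use ev in \<open>simp_all add: solves_def\<close>)
  moreover have "\<forall>\<^sub>F h in at_right 0. (1 / h) *\<^sub>R (W h a - V a c)
      = (1 / h) *\<^sub>R (parallel_transport_back A nabla \<gamma> a (a + h) (V (a + h)) c - V a c)"
    using small ev
  proof eventually_elim
    case (elim h)
    interpret piece: curve_in_chart X A nabla c \<gamma> x' a "a + h"
      by (rule initial_piece) (use elim in auto)
    have "tangent_of A c (\<gamma> (a + h)) (W h (a + h)) = V (a + h)"
      using elim(1) elim(2)[unfolded solves_def]
        tangent_eq_tangent_of[OF V chart_at, of "a + h"] by simp
    then have "parallel_transport_back A nabla \<gamma> a (a + h) (V (a + h)) = tangent_of A c (\<gamma> a) (W h a)"
      using piece.parallel_transport_back_eq[of K "W h"] bound K Kh[of h] elim(1)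
        elim(2)[unfolded solves_def] by simp
    then show ?case using ab by (simp add: tangent_of_component chart_at)
  qed
  ultimately show ?thesis by (simp add: transport_rhs_def tendsto_cong)
qed

end

section \<open>The string in a chart\<close>

text \<open>A rectangle \<open>M \<times> J\<close> of parameters in which the string stays in one chart, where \<open>F\<close> extends its
  coordinate expression smoothly beyond the ends of the string. The extension turns the one-sided
  derivatives at the ends into ordinary partial derivatives of \<open>F\<close>.\<close>

locale string_in_chart = surface_with_connection X A nabla for X :: "'p topology" and A nabla +
  fixes L :: real and u :: "real \<Rightarrow> real \<Rightarrow> 'p" and c :: "'p chart"
    and M J :: "real set" and F :: "real \<times> real \<Rightarrow> real ^ 2"
  assumes L_pos: "L > 0" and chart: "c \<in> A"
    and open_M: "open M" and open_J: "open J" and smooth_F: "smooth_on (M \<times> J) F"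
    and in_chart: "\<And>m t. m \<in> M \<Longrightarrow> t \<in> J \<Longrightarrow> m \<in> {0..L} \<Longrightarrow> u m t \<in> cdom c"
    and F_eq: "\<And>m t. m \<in> M \<Longrightarrow> t \<in> J \<Longrightarrow> m \<in> {0..L} \<Longrightarrow> F (m, t) = cmap c (u m t)"
begin

definition Fm :: "real \<times> real \<Rightarrow> real ^ 2" where "Fm z = frechet_derivative F (at z) (1, 0)"
definition Ft :: "real \<times> real \<Rightarrow> real ^ 2" where "Ft z = frechet_derivative F (at z) (0, 1)"
definition Fmm :: "real \<times> real \<Rightarrow> real ^ 2" where "Fmm z = frechet_derivative Fm (at z) (1, 0)"
definition Ftt :: "real \<times> real \<Rightarrow> real ^ 2" where "Ftt z = frechet_derivative Ft (at z) (0, 1)"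

lemma smooth_partials:
  "smooth_on (M \<times> J) Fm" "smooth_on (M \<times> J) Ft" "smooth_on (M \<times> J) Fmm" "smooth_on (M \<times> J) Ftt"
proof -
  show 1: "smooth_on (M \<times> J) Fm" unfolding Fm_def[abs_def] by (rule smooth_on_directional[OF smooth_F])
  show 2: "smooth_on (M \<times> J) Ft" unfolding Ft_def[abs_def] by (rule smooth_on_directional[OF smooth_F])
  show "smooth_on (M \<times> J) Fmm" unfolding Fmm_def[abs_def] by (rule smooth_on_directional[OF 1])
  show "smooth_on (M \<times> J) Ftt" unfolding Ftt_def[abs_def] by (rule smooth_on_directional[OF 2])
qed

lemma chart_at: "m \<in> M \<Longrightarrow> t \<in> J \<Longrightarrow> m \<in> {0..L} \<Longrightarrow> c \<in> charts_at A (u m t)"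
  using chart in_chart by (simp add: charts_at_def)

lemma eventually_m:
  assumes "m \<in> M" shows "\<forall>\<^sub>F r in at m within {0..L}. r \<in> M \<and> r \<in> {0..L}"
  unfolding eventually_at_topological using open_M assms by blast

lemma eventually_t: assumes "t \<in> J" shows "\<forall>\<^sub>F r in at t. r \<in> J"
  by (rule eventually_at_in_open'[OF open_J assms])

context
  fixes m t assumes m: "m \<in> M" "m \<in> {0..L}" and t: "t \<in> J"
begin

lemma chart_deriv_m:
  "((\<lambda>r. cmap c (u r t)) has_vector_derivative Fm (m, t)) (at m within {0..L})"
proof (rule has_vector_derivative_transform_eventually)
  show "((\<lambda>r. F (r, t)) has_vector_derivative Fm (m, t)) (at m within {0..L})"
    unfolding Fm_def using m t by (intro smooth_on_partial_derivatives[OF smooth_F]) simp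
  show "\<forall>\<^sub>F r in at m within {0..L}. F (r, t) = cmap c (u r t)"
    using eventually_m[OF m(1)] by eventually_elim (use t F_eq in auto)
qed (use m t F_eq in auto)

lemma chart_deriv_t:
  "((\<lambda>r. cmap c (u m r)) has_vector_derivative Ft (m, t)) (at t within UNIV)"
proof (rule has_vector_derivative_transform_eventually)
  show "((\<lambda>r. F (m, r)) has_vector_derivative Ft (m, t)) (at t within UNIV)"
    unfolding Ft_def using m t by (intro smooth_on_partial_derivatives[OF smooth_F]) simp
  show "\<forall>\<^sub>F r in at t within UNIV. F (m, r) = cmap c (u m r)"
    using eventually_t[OF t] by eventually_elim (use m F_eq in auto)
qed (use m t F_eq in auto)

lemma eventually_chart_m: "\<forall>\<^sub>F r in at m within {0..L}. u r t \<in> cdom c"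
  using eventually_m[OF m(1)] by eventually_elim (use t in_chart in auto)

lemma eventually_chart_t: "\<forall>\<^sub>F r in at t within UNIV. u m r \<in> cdom c"
  using eventually_t[OF t] by eventually_elim (use m in_chart in auto)

lemma u_m_eq: "u_m A L u m t = tangent_of A c (u m t) (Fm (m, t))"
  unfolding u_m_def
  by (rule velocity_eq_tangent_of[of c "\<lambda>r. u r t", OF chart_at[OF m(1) t m(2)] m(2)
        at_within_Icc_nontrivial[OF L_pos m(2)] chart_deriv_m eventually_chart_m])

lemma u_t_eq: "u_t A u m t = tangent_of A c (u m t) (Ft (m, t))"
  unfolding u_t_def
  by (rule velocity_eq_tangent_of[of c "u m", OF chart_at[OF m(1) t m(2)] UNIV_I
        _ chart_deriv_t eventually_chart_t]) simp

lemma u_m_component: "u_m A L u m t c = Fm (m, t)"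
  unfolding u_m_eq by (rule tangent_of_component[OF chart_at[OF m(1) t m(2)]])

lemma u_t_component: "u_t A u m t c = Ft (m, t)"
  unfolding u_t_eq by (rule tangent_of_component[OF chart_at[OF m(1) t m(2)]])

end

lemma u_m_component_derivative:
  assumes m: "m \<in> M" "m \<in> {0..L}" and t: "t \<in> J"
  shows "((\<lambda>r. u_m A L u r t c) has_vector_derivative Fmm (m, t)) (at m within {0..L})"
proof (rule has_vector_derivative_transform_eventually)
  show "((\<lambda>r. Fm (r, t)) has_vector_derivative Fmm (m, t)) (at m within {0..L})"
    unfolding Fmm_def using m t by (intro smooth_on_partial_derivatives[OF smooth_partials(1)]) simp
  show "\<forall>\<^sub>F r in at m within {0..L}. Fm (r, t) = u_m A L u r t c"
    using eventually_m[OF m(1)] by eventually_elim (use t u_m_component in auto)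
qed (use m t u_m_component in auto)

lemma u_t_component_derivative:
  assumes m: "m \<in> M" "m \<in> {0..L}" and t: "t \<in> J"
  shows "((\<lambda>r. u_t A u m r c) has_vector_derivative Ftt (m, t)) (at t within UNIV)"
proof (rule has_vector_derivative_transform_eventually)
  show "((\<lambda>r. Ft (m, r)) has_vector_derivative Ftt (m, t)) (at t within UNIV)"
    unfolding Ftt_def using m t by (intro smooth_on_partial_derivatives[OF smooth_partials(2)]) simp
  show "\<forall>\<^sub>F r in at t within UNIV. Ft (m, r) = u_t A u m r c"
    using eventually_t[OF t] by eventually_elim (use m u_t_component in auto)
qed (use m t u_t_component in auto)

lemma nabla_m_component:
  assumes m: "m \<in> M" "m \<in> {0..L}" and t: "t \<in> J"
  shows "nabla_m A nabla L u (u_m A L u) m t c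
    = Fmm (m, t) + christoffel_term c (F (m, t)) (Fm (m, t)) (Fm (m, t))"
  unfolding nabla_m_def
  using cov_deriv_along_component[of c "\<lambda>r. u r t", OF chart_at[OF m(1) t m(2)] m(2)
        at_within_Icc_nontrivial[OF L_pos m(2)] chart_deriv_m[OF m t] eventually_chart_m[OF m t]]
    vector_derivative_within[OF at_within_Icc_nontrivial[OF L_pos m(2)] u_m_component_derivative[OF m t]]
  by (simp add: u_m_component[OF m t] F_eq[OF m(1) t m(2)])

lemma nabla_t_component:
  assumes m: "m \<in> M" "m \<in> {0..L}" and t: "t \<in> J"
  shows "nabla_t A nabla u (u_t A u) m t c
    = Ftt (m, t) + christoffel_term c (F (m, t)) (Ft (m, t)) (Ft (m, t))"
  unfolding nabla_t_def
  using cov_deriv_along_component[of c "u m", OF chart_at[OF m(1) t m(2)] UNIV_I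
        _ chart_deriv_t[OF m t] eventually_chart_t[OF m t]]
    vector_derivative_within[OF _ u_t_component_derivative[OF m t]]
  by (simp add: u_t_component[OF m t] F_eq[OF m(1) t m(2)])

lemma continuous_on_partial:
  assumes "smooth_on (M \<times> J) G" "t \<in> J"
  shows "continuous_on (M \<inter> {0..L}) (\<lambda>m. G (m, t))"
  by (rule continuous_on_compose2[OF smooth_on_continuous_on[OF assms(1)]])
    (use assms(2) in \<open>auto intro!: continuous_intros\<close>)

lemma continuous_on_christoffel_term:
  assumes G: "smooth_on (M \<times> J) G" and t: "t \<in> J"
  shows "continuous_on (M \<inter> {0..L}) (\<lambda>m. christoffel_term c (F (m, t)) (G (m, t)) (G (m, t)))"
proof -
  have "continuous_on (M \<inter> {0..L}) (\<lambda>m. christoffel c i j (F (m, t)))" for i j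
    by (rule continuous_on_compose2[OF smooth_on_continuous_on[OF smooth_christoffel[OF chart]]
          continuous_on_partial[OF smooth_F t]]) (use t F_eq in_chart in auto)
  then show ?thesis unfolding christoffel_term_def
    by (intro continuous_intros continuous_on_partial[OF G t])
qed

lemma continuous_on_nabla_m:
  assumes t: "t \<in> J"
  shows "continuous_on (M \<inter> {0..L}) (\<lambda>m. nabla_m A nabla L u (u_m A L u) m t c)"
proof -
  have "continuous_on (M \<inter> {0..L}) (\<lambda>m. Fmm (m, t) + christoffel_term c (F (m, t)) (Fm (m, t)) (Fm (m, t)))"
    by (intro continuous_on_add continuous_on_partial continuous_on_christoffel_term smooth_partials t)
  then show ?thesis by (rule continuous_on_eq) (use t in \<open>auto simp: nabla_m_component\<close>)
qed

lemma continuous_on_nabla_t: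
  assumes t: "t \<in> J"
  shows "continuous_on (M \<inter> {0..L}) (\<lambda>m. nabla_t A nabla u (u_t A u) m t c)"
proof -
  have "continuous_on (M \<inter> {0..L}) (\<lambda>m. Ftt (m, t) + christoffel_term c (F (m, t)) (Ft (m, t)) (Ft (m, t)))"
    by (intro continuous_on_add continuous_on_partial continuous_on_christoffel_term smooth_partials t)
  then show ?thesis by (rule continuous_on_eq) (use t in \<open>auto simp: nabla_t_component\<close>)
qed

text \<open>The limit occurring in Newton's Law, for a multiple of \<open>u_m\<close>. The string is restricted to a piece
  \<open>{m..b}\<close> inside the chart.\<close>

lemma transport_quotient_tendsto_nabla_m:
  assumes m: "m \<in> M" "0 < m" "m < L" and t: "t \<in> J"
  shows "((\<lambda>h. (1 / h) *\<^sub>R (parallel_transport_back A nabla (\<lambda>r. u r t) m (m + h)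
        (k *\<^sub>R u_m A L u (m + h) t) c - (k *\<^sub>R u_m A L u m t) c))
    \<longlongrightarrow> k *\<^sub>R nabla_m A nabla L u (u_m A L u) m t c) (at_right 0)"
proof -
  obtain e where e: "e > 0" "ball m e \<subseteq> M" using open_M m(1) open_contains_ball by blast
  define b where "b = m + min (e / 2) (L - m)"
  have mb: "m < b" and sub: "{m..b} \<subseteq> M" "{m..b} \<subseteq> {0..L}"
    using e m by (auto simp: b_def dist_real_def intro!: subsetD[OF e(2)])
  interpret curve: curve_in_chart X A nabla c "\<lambda>r. u r t" "\<lambda>r. Fm (r, t)" m b
  proof
    show "((\<lambda>s. cmap c (u s t)) has_vector_derivative Fm (s, t)) (at s within {m..b})"
      if "s \<in> {m..b}" for s
      using has_vector_derivative_within_subset[OF chart_deriv_m sub(2)] that sub t by blast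
    show "continuous_on {m..b} (\<lambda>r. Fm (r, t))"
      by (rule continuous_on_subset[OF continuous_on_partial[OF smooth_partials(1) t]]) (use sub in auto)
  qed (use chart mb sub in_chart t in auto)
  have "((\<lambda>h. (1 / h) *\<^sub>R (parallel_transport_back A nabla (\<lambda>r. u r t) m (m + h)
        (k *\<^sub>R u_m A L u (m + h) t) c - (k *\<^sub>R u_m A L u m t) c))
    \<longlongrightarrow> k *\<^sub>R Fmm (m, t) + christoffel_term c (cmap c (u m t)) (Fm (m, t)) ((k *\<^sub>R u_m A L u m t) c))
    (at_right 0)"
  proof (rule curve.covariant_derivative_by_transport)
    fix s assume s: "s \<in> {m..b}"
    then have sm: "s \<in> M" "s \<in> {0..L}" using sub by auto
    show "k *\<^sub>R u_m A L u s t \<in> tangent_space A (u s t)"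
      unfolding u_m_eq[OF sm t]
      by (intro tangent_space_scaleR tangent_of_in_tangent_space chart_at sm t)
    show "((\<lambda>r. (k *\<^sub>R u_m A L u r t) c) has_vector_derivative k *\<^sub>R Fmm (s, t)) (at s within {m..b})"
      unfolding scaleR_fun_def
      by (intro bounded_linear.has_vector_derivative[OF bounded_linear_scaleR_right]
          has_vector_derivative_within_subset[OF u_m_component_derivative[OF sm t] sub(2)])
  next
    show "continuous_on {m..b} (\<lambda>s. k *\<^sub>R Fmm (s, t))"
      by (intro continuous_intros continuous_on_subset[OF continuous_on_partial[OF smooth_partials(3) t]])
        (use sub in auto)
  qed
  moreover have "k *\<^sub>R Fmm (m, t) + christoffel_term c (cmap c (u m t)) (Fm (m, t)) ((k *\<^sub>R u_m A L u m t) c)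
      = k *\<^sub>R nabla_m A nabla L u (u_m A L u) m t c"
    using m t by (simp add: nabla_m_component u_m_component F_eq scaleR_fun_def christoffel_term_def
        sum_2 algebra_simps)
  ultimately show ?thesis by simp
qed

end

text \<open>Smoothness gives an extension of the coordinates near \<open>(m, t)\<close>, and continuity of \<open>u\<close> keeps nearby
  points of the string in the domain of the chart; a product neighbourhood serves both purposes.\<close>

lemma obtain_string_in_chart:
  assumes conn: "surface_with_connection X A nabla" and L: "L > 0"
    and smooth: "smooth_map_on X A ({0..L} \<times> UNIV) (\<lambda>(m, t). u m t)"
    and m: "m \<in> {0..L}" and c: "c \<in> charts_at A (u m t)"
  obtains M J F where "m \<in> M" "t \<in> J" "string_in_chart X A nabla L u c M J F"
proof -
  interpret surface_with_connection X A nabla by (rule conn)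
  let ?S = "{0..L} \<times> UNIV :: (real \<times> real) set"
  have cA: "c \<in> A" and p: "u m t \<in> cdom c" using c by (auto simp: charts_at_def)
  have cont: "continuous_map (top_of_set ?S) X (\<lambda>(m, t). u m t)"
    using smooth by (simp add: smooth_map_on_def)
  obtain N F where N: "open N" "(m, t) \<in> N" "smooth_on N F"
    and F: "\<And>w. w \<in> N \<inter> ?S \<Longrightarrow> (case w of (m, t) \<Rightarrow> u m t) \<in> cdom c \<Longrightarrow> F w = cmap c (case w of (m, t) \<Rightarrow> u m t)"
  proof -
    have "\<exists>N F. open N \<and> (m, t) \<in> N \<and> smooth_on N F \<and>
        (\<forall>w\<in>N \<inter> ?S. (case w of (m, t) \<Rightarrow> u m t) \<in> cdom c \<longrightarrow> F w = cmap c (case w of (m, t) \<Rightarrow> u m t))"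
      by (rule smooth[unfolded smooth_map_on_def, THEN conjunct2, THEN bspec, OF cA, THEN bspec, THEN mp])
        (use m p in simp_all)
    then show ?thesis using that by blast
  qed
  have "openin (top_of_set ?S) {w \<in> ?S. (case w of (m, t) \<Rightarrow> u m t) \<in> cdom c}"
    using openin_continuous_map_preimage[OF cont cdom_open[OF cA]] by simp
  then have "\<exists>T. open T \<and> {w \<in> ?S. (case w of (m, t) \<Rightarrow> u m t) \<in> cdom c} = ?S \<inter> T"
    unfolding openin_open .
  then obtain O' where O': "open O'" "{w \<in> ?S. (case w of (m, t) \<Rightarrow> u m t) \<in> cdom c} = ?S \<inter> O'"
    by (elim exE conjE)
  have preimage: "(r, s) \<in> O' \<longleftrightarrow> u r s \<in> cdom c" if "r \<in> {0..L}" for r s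
    using O'(2)[unfolded set_eq_iff, THEN spec, of "(r, s)"] that by simp
  have "(m, t) \<in> O'" using preimage[OF m] p by simp
  then have "open (N \<inter> O')" "(m, t) \<in> N \<inter> O'" using N O' by auto
  then obtain M J where MJ: "open M" "open J" "(m, t) \<in> M \<times> J" "M \<times> J \<subseteq> N \<inter> O'"
    by (rule open_prod_elim)
  have chart: "u r s \<in> cdom c" if "r \<in> M" "s \<in> J" "r \<in> {0..L}" for r s
    using MJ(4) preimage[OF that(3)] that by blast
  have "string_in_chart X A nabla L u c M J F"
  proof
    show "smooth_on (M \<times> J) F" by (rule smooth_on_subset[OF N(3)]) (use MJ in auto)
    show "F (r, s) = cmap c (u r s)" if "r \<in> M" "s \<in> J" "r \<in> {0..L}" for r s
      using F[of "(r, s)"] chart[OF that] that MJ(4) by auto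
  qed (use L cA MJ chart in auto)
  then show ?thesis using that MJ(3) by blast
qed

section \<open>The tension and the wave map equation\<close>

text \<open>The factors \<open>\<sigma>\<close> and \<open>inverse \<sigma>\<close> cancel unless \<open>\<sigma> = 0\<close>, and by positivity of the metric this happens
  only where \<open>u_m = 0\<close>.\<close>

lemma tension_eq_scaled_u_m:
  assumes metric: "riemannian_metric X A g" and elastic: "perfectly_elastic A g L u T T0"
    and m: "m \<in> {0..L}" and p: "u m t \<in> topspace X"
    and tangent: "u_m A L u m t \<in> tangent_space A (u m t)"
  shows "tension A g L u T m t = T0 *\<^sub>R u_m A L u m t"
proof -
  let ?v = "u_m A L u m t"
  have pos: "?v \<noteq> 0 \<Longrightarrow> g (u m t) ?v ?v > 0"
    using metric[unfolded riemannian_metric_def, THEN conjunct1] p tangent by blast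
  have T: "T m t = T0 * tnorm g (u m t) ?v"
    using elastic m by (simp add: perfectly_elastic_def stretching_def)
  show ?thesis
  proof (cases "?v = 0")
    case True
    then show ?thesis by (simp add: tension_def unit_tangent_def)
  next
    case False
    then have "tnorm g (u m t) ?v \<noteq> 0" using pos by (simp add: tnorm_def)
    then show ?thesis by (simp add: tension_def unit_tangent_def T)
  qed
qed

theorem theorem4p3:
  fixes X :: "'p topology" and A :: "'p chart set"
    and g :: "'p \<Rightarrow> 'p tangent \<Rightarrow> 'p tangent \<Rightarrow> real" and nabla :: "'p connection"
    and L :: real and u :: "real \<Rightarrow> real \<Rightarrow> 'p"
    and mu :: "real \<Rightarrow> real" and T :: "real \<Rightarrow> real \<Rightarrow> real" and rho T0 c :: real
  assumes surface: "riemannian_surface X A g"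
    and levi_civita: "levi_civita_connection X A g nabla"
    and L_pos: "L > 0"
    and smooth: "smooth_map_on X A ({0..L} \<times> UNIV) (\<lambda>(m, t). u m t)"
    and density: "constant_density L mu rho"
    and elastic: "perfectly_elastic A g L u T T0"
    and newton: "newtons_law A g nabla L u mu T"
    and c: "c\<^sup>2 = T0 / rho"
  shows "\<forall>m\<in>{0..L}. \<forall>t.
           nabla_t A nabla u (u_t A u) m t = c\<^sup>2 *\<^sub>R nabla_m A nabla L u (u_m A L u) m t"
proof (intro ballI allI ext)
  have metric: "riemannian_metric X A g" using surface by (simp add: riemannian_surface_def)
  have conn: "surface_with_connection X A nabla"
    using surface levi_civita
    by unfold_locales (simp_all add: riemannian_surface_def levi_civita_connection_def)
  interpret surface_with_connection X A nabla by (rule conn)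
  have rho: "rho > 0" and mu: "\<And>m. m \<in> {0..L} \<Longrightarrow> mu m = rho"
    using density by (auto simp: constant_density_def)
  have tension: "tension A g L u T m t = T0 *\<^sub>R u_m A L u m t" if m: "m \<in> {0..L}" for m t
  proof -
    have p: "u m t \<in> topspace X"
      using funcset_mem[OF continuous_map_funspace[OF smooth[unfolded smooth_map_on_def, THEN conjunct1]],
          of "(m, t)"] m by simp
    moreover have "(\<Union>c\<in>A. cdom c) = topspace X"
      using smooth_atlas.surface[OF smooth_atlas_axioms] by (simp add: smooth_surface_def)
    ultimately obtain d where d: "d \<in> charts_at A (u m t)" unfolding charts_at_def by blast
    obtain M J F where MJ: "m \<in> M" "t \<in> J" and local: "string_in_chart X A nabla L u d M J F"
      using obtain_string_in_chart[OF conn L_pos smooth m d] by blast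
    have "u_m A L u m t \<in> tangent_space A (u m t)"
      unfolding string_in_chart.u_m_eq[OF local MJ(1) m MJ(2)] by (rule tangent_of_in_tangent_space[OF d])
    then show ?thesis by (rule tension_eq_scaled_u_m[OF metric elastic m p])
  qed
  fix m t d assume m: "m \<in> {0..L}"
  show "nabla_t A nabla u (u_t A u) m t d = (c\<^sup>2 *\<^sub>R nabla_m A nabla L u (u_m A L u) m t) d"
  proof (cases "d \<in> charts_at A (u m t)")
    case False
    then show ?thesis
      by (simp add: nabla_t_def nabla_m_def cov_deriv_along_def scaleR_fun_def)
  next
    case d: True
    obtain M J F where MJ: "m \<in> M" "t \<in> J" and local: "string_in_chart X A nabla L u d M J F"
      using obtain_string_in_chart[OF conn L_pos smooth m d] by blast
    interpret string_in_chart X A nabla L u d M J F by (rule local)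
    \<comment> \<open>The defect of the equation in the chart \<open>d\<close>. It vanishes for interior \<open>r\<close> by Newton's Law, and
      then at \<open>m\<close>, which may be an end of the string, by continuity.\<close>
    define D where "D r = rho *\<^sub>R nabla_t A nabla u (u_t A u) r t d
      - T0 *\<^sub>R nabla_m A nabla L u (u_m A L u) r t d" for r
    have interior: "D r = 0" if r: "r \<in> M" "0 < r" "r < L" for r
    proof -
      have "r \<in> {0<..<L}" using r by simp
      from tendsto_component[OF newton[unfolded newtons_law_def, THEN bspec, OF this, THEN spec, of t], of d]
      have newton': "((\<lambda>h. (1 / h) *\<^sub>R (parallel_transport_back A nabla (\<lambda>r. u r t) r (r + h)
            (tension A g L u T (r + h) t) d - tension A g L u T r t d))
          \<longlongrightarrow> rho *\<^sub>R nabla_t A nabla u (u_t A u) r t d) (at_right 0)"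
        using r by (simp add: scaleR_fun_def mu)
      have "0 < L - r" using r by simp
      then have "\<forall>\<^sub>F h in at_right 0. 0 < h \<and> h < L - r"
        unfolding eventually_at_right_field by blast
      then have ev: "\<forall>\<^sub>F h in at_right 0. (1 / h) *\<^sub>R (parallel_transport_back A nabla (\<lambda>r. u r t) r (r + h)
            (T0 *\<^sub>R u_m A L u (r + h) t) d - (T0 *\<^sub>R u_m A L u r t) d)
          = (1 / h) *\<^sub>R (parallel_transport_back A nabla (\<lambda>r. u r t) r (r + h)
            (tension A g L u T (r + h) t) d - tension A g L u T r t d)"
        by eventually_elim (use r in \<open>simp add: tension\<close>)
      have "((\<lambda>h. (1 / h) *\<^sub>R (parallel_transport_back A nabla (\<lambda>r. u r t) r (r + h)
            (tension A g L u T (r + h) t) d - tension A g L u T r t d))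
          \<longlongrightarrow> T0 *\<^sub>R nabla_m A nabla L u (u_m A L u) r t d) (at_right 0)"
        using transport_quotient_tendsto_nabla_m[OF r MJ(2), of T0] unfolding tendsto_cong[OF ev] .
      from tendsto_unique[OF _ newton' this] show ?thesis by (simp add: D_def)
    qed
    have "continuous_on (M \<inter> {0..L}) D"
      unfolding D_def by (intro continuous_intros continuous_on_nabla_t continuous_on_nabla_m MJ(2))
    then have "(D \<longlongrightarrow> D m) (at m within M \<inter> {0..L})"
      using MJ(1) m by (simp add: continuous_on_def)
    moreover have "at m within M \<inter> {0..L} = at m within {0..L}"
      by (rule at_within_nhd[OF MJ(1) open_M]) auto
    ultimately have "(D \<longlongrightarrow> D m) (at m within {0..L})" by simp
    then have "(D \<longlongrightarrow> D m) (at m within {0<..<L})" by (rule tendsto_within_subset) auto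
    moreover have "\<forall>\<^sub>F r in at m within {0<..<L}. D r = 0"
    proof -
      have "\<forall>\<^sub>F r in at m within {0<..<L}. r \<in> M"
        unfolding eventually_at_topological using open_M MJ(1) by blast
      moreover have "\<forall>\<^sub>F r in at m within {0<..<L}. r \<in> {0<..<L}"
        by (simp add: eventually_at_filter)
      ultimately show ?thesis by eventually_elim (auto intro: interior)
    qed
    then have "(D \<longlongrightarrow> 0) (at m within {0<..<L})" by (rule tendsto_eventually)
    moreover have "at m within {0<..<L} \<noteq> bot"
    proof -
      consider "m = 0" | "m = L" | "m \<in> {0<..<L}" using m by fastforce
      then show ?thesis
      proof cases
        case 1
        then show ?thesis using islimpt_greaterThanLessThan1[OF L_pos] by (simp add: trivial_limit_within)
      next
        case 2
        then show ?thesis using islimpt_greaterThanLessThan2[OF L_pos] by (simp add: trivial_limit_within)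
      next
        case 3
        then show ?thesis by (simp add: at_within_open[of m "{0<..<L}"])
      qed
    qed
    ultimately have "D m = 0" using tendsto_unique by blast
    then have "rho *\<^sub>R nabla_t A nabla u (u_t A u) m t d = T0 *\<^sub>R nabla_m A nabla L u (u_m A L u) m t d"
      by (simp add: D_def)
    then have "(1 / rho) *\<^sub>R rho *\<^sub>R nabla_t A nabla u (u_t A u) m t d
        = (1 / rho) *\<^sub>R T0 *\<^sub>R nabla_m A nabla L u (u_m A L u) m t d" by (rule arg_cong)
    then have "nabla_t A nabla u (u_t A u) m t d = (T0 / rho) *\<^sub>R nabla_m A nabla L u (u_m A L u) m t d"
      using rho by simp
    then show ?thesis by (simp add: c scaleR_fun_def)
  qed
qed

end
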